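(* If $k$ is a $P$-integer, then $k < 10^{1805}$.
   Context: An integer $k > 1$ is called a $P$-integer if the first $\phi(k)$ primes coprime to $k$ (that is, the $\phi(k)$ smallest primes not dividing $k$) form a reduced residue system modulo $k$. Here $\phi$ is Euler's totient function. *)

theory Defs
  imports "HOL-Number_Theory.Number_Theory" "HOL-Library.Infinite_Set"
begin

(* Residues are taken in nat: for k > 0 every integer class mod k contains a natural number. *)
definition reduced_residue_system :: "nat \<Rightarrow> nat set \<Rightarrow> bool" where
  "reduced_residue_system k S \<longleftrightarrow>
     (\<forall>s\<in>S. coprime s k) \<and> (\<forall>a. coprime a k \<longrightarrow> (\<exists>!s. s \<in> S \<and> [s = a] (mod k)))"

definition primes_coprime_to :: "nat \<Rightarrow> nat set" where
  "primes_coprime_to k = {p. prime p \<and> coprime p k}"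

(* enumerate lists an infinite set of naturals in increasing order, starting at index 0. *)
definition first_primes_coprime_to :: "nat \<Rightarrow> nat \<Rightarrow> nat set" where
  "first_primes_coprime_to n k = enumerate (primes_coprime_to k) ` {..<n}"

lemma infinite_primes_coprime_to:
  assumes "k > 0"
  shows "infinite (primes_coprime_to k)"
proof
  assume "finite (primes_coprime_to k)"
  moreover have "{p. prime p} \<subseteq> primes_coprime_to k \<union> {p. p dvd k}"
    unfolding primes_coprime_to_def using prime_imp_coprime by blast
  ultimately have "finite {p::nat. prime p}"
    using finite_divisors_nat[OF assms] finite_subset by blast
  then show False
    using primes_infinite by blast
qed

definition P_integer :: "nat \<Rightarrow> bool" where
  "P_integer k \<longleftrightarrow>
     k > 1 \<and> reduced_residue_system k (first_primes_coprime_to (totient k) k)"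

end

theory Submission
  imports Defs "HOL-Analysis.Harmonic_Numbers"
begin

text \<open>
  Let \<open>L = ln k\<close>. If every term of \<open>a, a + k, \<dots>, a + (J - 1) * k\<close> is composite, where \<open>a\<close> is coprime
  to \<open>k\<close>, then the least prime in the class of \<open>a\<close> exceeds \<open>J * k\<close>, and \<open>k\<close> is no P-integer as soon as
  there are at least \<open>\<phi>(k) + \<omega>(k)\<close> primes up to \<open>J * k\<close>; by Chebyshev's estimate, \<open>J\<close> slightly above
  \<open>(\<phi>(k) / k) * L / 0.9212\<close> suffices.

  To find \<open>a\<close>, cover \<open>{0..<J}\<close> by one residue class for each prime in a set of primes not dividing \<open>k\<close>:
  a prime \<open>q \<le> z\<close>, chosen greedily, removes a proportion \<open>1 / q\<close> of what is left, and the
  \<open>J * \<Prod>(1 - 1 / q)\<close> survivors are covered one at a time by primes in \<open>(z, X]\<close>. The Chinese remainder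
  theorem turns the covering into congruences for \<open>a\<close>; the primes up to \<open>z\<close> that divide \<open>k\<close> are
  added to the modulus, and those beyond \<open>z\<close> are avoided by a union bound. Since
  \<open>(\<phi>(k) / k) * \<Prod>(1 - 1 / q)\<close> is at most the Mertens product \<open>\<Prod>(1 - 1 / p)\<close> over all primes \<open>p \<le> z\<close>, about
  \<open>exp (- \<gamma>) / ln z\<close>, there is a factor \<open>exp \<gamma> = 1.78\<dots>\<close> to spare, which pays for the losses once
  \<open>k\<close> is as large as \<open>10 ^ 1805\<close>.
\<close>

subsection \<open>Covering an interval and avoiding primes\<close>

text \<open>The representative of the class of \<open>a\<close> is entry
  \<open>i < totient k\<close> of the increasing enumeration, and every smaller prime coprime to
  \<open>k\<close> is an earlier entry. A class with no small primes will contradict this.\<close>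

lemma P_integer_prime_in_class:
  assumes "P_integer k" "coprime a k"
  obtains s where "prime s" "[s = a] (mod k)"
    "card {p. prime p \<and> coprime p k \<and> p < s} < totient k"
proof -
  let ?S = "primes_coprime_to k"
  have k: "k > 1" and r: "reduced_residue_system k (first_primes_coprime_to (totient k) k)"
    using assms(1) by (auto simp: P_integer_def)
  have inf: "infinite ?S"
    using infinite_primes_coprime_to k by simp
  obtain i where i: "i < totient k" "[enumerate ?S i = a] (mod k)"
    using r assms(2) unfolding reduced_residue_system_def first_primes_coprime_to_def by blast
  have "{p. prime p \<and> coprime p k \<and> p < enumerate ?S i} \<subseteq> enumerate ?S ` {..<i}"
  proof
    fix p assume "p \<in> {p. prime p \<and> coprime p k \<and> p < enumerate ?S i}"
    then have p: "p \<in> ?S" "p < enumerate ?S i"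
      by (auto simp: primes_coprime_to_def)
    then obtain n where "enumerate ?S n = p"
      using enumerate_Ex inf by blast
    with p inf show "p \<in> enumerate ?S ` {..<i}"
      by auto
  qed
  then have "card {p. prime p \<and> coprime p k \<and> p < enumerate ?S i} \<le> card {..<i}"
    by (rule surj_card_le[OF finite_lessThan])
  with i that[of "enumerate ?S i"] enumerate_in_set[OF inf, of i] show thesis
    by (auto simp: primes_coprime_to_def)
qed

section \<open>Covering an interval with one residue class per modulus\<close>

lemma residue_class_of_large_card:
  fixes R :: "nat set" and q :: nat
  assumes "finite R" "q > 0"
  shows "\<exists>r. real (card {j\<in>R. j mod q \<noteq> r}) \<le> card R * (1 - 1 / q)"
proof (rule ccontr)
  assume "\<not> ?thesis"
  then have *: "real (card {j\<in>R. j mod q \<noteq> r}) > card R * (1 - 1 / q)" for r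
    by (auto simp: not_le)
  \<comment> \<open>If no class removed a proportion \<open>1 / q\<close>, every class would hold
    fewer than \<open>card R / q\<close> elements, and the sum over the \<open>q\<close> classes
    would fall short of \<open>card R\<close>.\<close>
  have **: "real (card {j\<in>R. j mod q = r}) < card R / q" for r
  proof -
    have "card R = card {j\<in>R. j mod q = r} + card {j\<in>R. j mod q \<noteq> r}"
      using assms by (subst card_Un_disjoint [symmetric]) (auto intro!: arg_cong[where f = card])
    then show ?thesis using *[of r] by (simp add: algebra_simps add_divide_distrib)
  qed
  have "R = (\<Union>r\<in>{..<q}. {j\<in>R. j mod q = r})"
    using assms by auto
  then have "card R = card (\<Union>r\<in>{..<q}. {j\<in>R. j mod q = r})"
    by simp
  also have "\<dots> = (\<Sum>r<q. card {j\<in>R. j mod q = r})"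
    using assms by (intro card_UN_disjoint) auto
  finally have "real (card R) = (\<Sum>r<q. real (card {j\<in>R. j mod q = r}))"
    by simp
  also have "\<dots> < (\<Sum>r<q. card R / q)"
    using assms by (intro sum_strict_mono **) auto
  finally show False using assms by simp
qed

text \<open>Each modulus in turn takes a most populated class among the elements that survived the
  earlier moduli.\<close>

lemma greedy_residues:
  fixes R Q :: "nat set"
  assumes "finite Q" "finite R" "\<And>q. q \<in> Q \<Longrightarrow> q > 0"
  shows "\<exists>r. real (card {j\<in>R. \<forall>q\<in>Q. j mod q \<noteq> r q}) \<le> card R * (\<Prod>q\<in>Q. 1 - 1 / q)"
  using assms(1,3)
proof (induction Q)
  case empty
  then show ?case by simp
next
  case (insert q Q)
  then obtain r where r: "real (card {j\<in>R. \<forall>q\<in>Q. j mod q \<noteq> r q}) \<le> card R * (\<Prod>q\<in>Q. 1 - 1 / q)"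
    by auto
  let ?R = "{j\<in>R. \<forall>q\<in>Q. j mod q \<noteq> r q}"
  obtain s where s: "real (card {j\<in>?R. j mod q \<noteq> s}) \<le> card ?R * (1 - 1 / q)"
    using residue_class_of_large_card[of ?R q] assms(2) insert by auto
  have q: "q > 0" using insert by auto
  have "{j\<in>R. \<forall>p\<in>insert q Q. j mod p \<noteq> (r(q := s)) p} = {j\<in>?R. j mod q \<noteq> s}"
    using insert.hyps by auto
  then have "real (card {j\<in>R. \<forall>p\<in>insert q Q. j mod p \<noteq> (r(q := s)) p}) \<le> card ?R * (1 - 1 / q)"
    using s by simp
  also have "\<dots> \<le> (card R * (\<Prod>q\<in>Q. 1 - 1 / q)) * (1 - 1 / q)"
    using q by (intro mult_right_mono r) auto
  finally show ?case
    using insert.hyps by (intro exI[of _ "r(q := s)"]) (simp add: mult_ac)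
qed

text \<open>An injection \<open>g\<close> from \<open>R\<close> into \<open>S\<close> gives every
  element \<open>j\<close> a modulus \<open>g j\<close> of its own, whose residue is then set to
  that of \<open>j\<close>.\<close>

lemma one_residue_each:
  fixes R S :: "nat set"
  assumes "finite R" "finite S" "card R \<le> card S"
  shows "\<exists>r. \<forall>j\<in>R. \<exists>q\<in>S. j mod q = r q"
proof -
  obtain g where g: "g ` R \<subseteq> S" "inj_on g R"
    using card_le_inj[OF assms] by blast
  then show ?thesis
    by (intro exI[of _ "\<lambda>q. inv_into R g q mod q"]) (auto intro!: bexI[of _ "g _"])
qed

text \<open>Two phases: the greedy choice on \<open>Q\<close> leaves at most \<open>card S\<close>
  elements, and the moduli in \<open>S\<close> then cover these one at a time.\<close>

lemma covering_residues:
  fixes Q S :: "nat set"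
  assumes "finite Q" "finite S" "Q \<inter> S = {}" "\<And>q. q \<in> Q \<Longrightarrow> q > 0"
    and "real J * (\<Prod>q\<in>Q. 1 - 1 / q) \<le> card S"
  shows "\<exists>r. \<forall>j<J. \<exists>q\<in>Q \<union> S. j mod q = r q"
proof -
  obtain r where r: "real (card {j\<in>{..<J}. \<forall>q\<in>Q. j mod q \<noteq> r q}) \<le> J * (\<Prod>q\<in>Q. 1 - 1 / q)"
    using greedy_residues[of Q "{..<J}"] assms by auto
  define R where "R = {j\<in>{..<J}. \<forall>q\<in>Q. j mod q \<noteq> r q}"
  have "finite R" "card R \<le> card S"
    using r assms(5) by (simp_all add: R_def)
  then obtain r' where r': "\<forall>j\<in>R. \<exists>q\<in>S. j mod q = r' q"
    using one_residue_each assms(2) by blast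
  let ?r = "\<lambda>q. if q \<in> Q then r q else r' q"
  have "\<exists>q\<in>Q \<union> S. j mod q = ?r q" if j: "j < J" for j
  proof (cases "j \<in> R")
    case True
    then obtain q where "q \<in> S" "j mod q = r' q" using r' by blast
    moreover have "q \<notin> Q" using assms(3) \<open>q \<in> S\<close> by blast
    ultimately show ?thesis by auto
  next
    case False
    then obtain q where "q \<in> Q" "j mod q = r q" using j by (auto simp: R_def)
    then show ?thesis by auto
  qed
  then show ?thesis by (intro exI[of _ ?r]) blast
qed

section \<open>Terms of a progression avoiding given primes\<close>

lemma card_multiples_in_progression:
  fixes p :: nat
  assumes "prime p" "\<not> p dvd M"
  shows "card {u\<in>{1..U}. p dvd a + u * M} \<le> U div p + 1"
proof -
  have p: "p > 0" using assms prime_gt_0_nat by blast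
  \<comment> \<open>As \<open>M\<close> is invertible modulo \<open>p\<close>, the condition
    \<open>p dvd a + u * M\<close> fixes \<open>u mod p\<close>, so \<open>u\<close> is determined
    by \<open>u div p\<close>.\<close>
  have "inj_on (\<lambda>u. u div p) {u\<in>{1..U}. p dvd a + u * M}"
  proof (rule inj_onI)
    fix u v assume uv: "u \<in> {u\<in>{1..U}. p dvd a + u * M}" "v \<in> {u\<in>{1..U}. p dvd a + u * M}"
      and eq: "u div p = v div p"
    have "[a + u * M = a + v * M] (mod p)"
      using uv by (simp add: cong_def mod_eq_0_iff_dvd)
    then have "[u * M = v * M] (mod p)"
      by (simp add: cong_add_lcancel_nat)
    moreover have "coprime M p"
      using assms by (metis prime_imp_coprime coprime_commute)
    ultimately have "[u = v] (mod p)"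
      using cong_mult_rcancel_nat by blast
    then have "u mod p = v mod p"
      by (simp add: cong_def)
    with eq show "u = v"
      by (metis div_mult_mod_eq)
  qed
  then have "card {u\<in>{1..U}. p dvd a + u * M} \<le> card {..U div p}"
    by (rule card_inj_on_le) (auto intro: div_le_mono)
  then show ?thesis by simp
qed

text \<open>A union bound: the values of \<open>u\<close> spoiled by some prime in \<open>K\<close>
  are fewer than \<open>U\<close>.\<close>

lemma sieve_progression:
  fixes K :: "nat set"
  assumes "finite K" "\<And>p. p \<in> K \<Longrightarrow> prime p \<and> \<not> p dvd M"
    and "(\<Sum>p\<in>K. real U / p + 1) < U"
  shows "\<exists>u\<in>{1..U}. \<forall>p\<in>K. \<not> p dvd a + u * M"
proof (rule ccontr)
  assume "\<not> ?thesis"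
  then have "{1..U} \<subseteq> (\<Union>p\<in>K. {u\<in>{1..U}. p dvd a + u * M})"
    by blast
  then have "card {1..U} \<le> card (\<Union>p\<in>K. {u\<in>{1..U}. p dvd a + u * M})"
    using assms(1) by (intro card_mono) auto
  also have "\<dots> \<le> (\<Sum>p\<in>K. card {u\<in>{1..U}. p dvd a + u * M})"
    using assms(1) by (rule card_UN_le)
  also have "\<dots> \<le> (\<Sum>p\<in>K. U div p + 1)"
    using assms(2) by (intro sum_mono card_multiples_in_progression) auto
  finally have "real U \<le> (\<Sum>p\<in>K. real (U div p) + 1)"
    using of_nat_mono[of "card {1..U}" "\<Sum>p\<in>K. U div p + 1", where 'a = real] by (simp add: add_ac)
  also have "\<dots> \<le> (\<Sum>p\<in>K. real U / p + 1)"
    by (intro sum_mono add_right_mono) (simp add: of_nat_div_le_of_nat)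
  finally show False using assms(3) by simp
qed

text \<open>The primes up to \<open>z\<close> not dividing \<open>k\<close> cover the indices
  \<open>j < J\<close> together with \<open>S\<close>; the primes up to \<open>z\<close> dividing
  \<open>k\<close> only enforce coprimality. The result is a class modulo \<open>M\<close>, and the
  term \<open>a0 + u * M\<close> is chosen to dodge the prime divisors of \<open>k\<close> beyond
  \<open>z\<close>. The hypothesis \<open>size\<close> keeps it below \<open>k\<close>.\<close>

lemma prime_free_progression:
  fixes k z U J :: nat and S :: "nat set"
  assumes "k > 0" "z \<ge> 3" "finite S" "\<And>q. q \<in> S \<Longrightarrow> prime q \<and> z < q \<and> \<not> q dvd k"
    and size: "(U + 1) * (\<Prod>{p. prime p \<and> p \<le> z} * \<Prod>S) \<le> k"
    and cover: "real J * (\<Prod>q | prime q \<and> q \<le> z \<and> \<not> q dvd k. 1 - 1 / q) \<le> card S"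
    and sieve: "(\<Sum>p | prime p \<and> p dvd k \<and> z < p. real U / p + 1) < U"
  obtains a where "0 < a" "a < k" "coprime a k" "\<And>j. j < J \<Longrightarrow> \<not> prime (a + j * k)"
proof -
  define Q where "Q = {q. prime q \<and> q \<le> z \<and> \<not> q dvd k}"
  define P where "P = {p. prime p \<and> p \<le> z} \<union> S"
  define M where "M = \<Prod>P"
  have fin: "finite {p. prime p \<and> p \<le> z}" "finite Q" "finite P"
    unfolding Q_def P_def using assms(3) by (auto intro: finite_subset[of _ "{..z}"])
  have prime_P: "prime p" if "p \<in> P" for p
    using that assms(4) by (auto simp: P_def)
  have M: "M = \<Prod>{p. prime p \<and> p \<le> z} * \<Prod>S"
    unfolding M_def P_def using fin assms(3) by (intro prod.union_disjoint) (auto dest: assms(4))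
  obtain r where r: "\<forall>j<J. \<exists>q\<in>Q \<union> S. j mod q = r q"
  proof -
    have "Q \<inter> S = {}" by (auto simp: Q_def dest: assms(4))
    then show thesis
      using covering_residues[of Q S J] fin(2) assms(3) cover that
      by (auto simp: Q_def prime_gt_0_nat)
  qed
  \<comment> \<open>For \<open>p\<close> not dividing \<open>k\<close> this is the residue
    \<open>- r p * k\<close>, with \<open>p - 1\<close> in place of \<open>-1\<close> to stay in the
    naturals; then \<open>p\<close> divides \<open>a + j * k\<close> whenever \<open>j\<close> has
    residue \<open>r p\<close>. For \<open>p\<close> dividing \<open>k\<close>, the residue 1 keeps
    \<open>p\<close> from dividing \<open>a\<close>.\<close>
  define c where "c p = (if p dvd k then 1 else (p - 1) * (r p * k))" for p
  have "\<forall>i\<in>P. \<forall>j\<in>P. i \<noteq> j \<longrightarrow> coprime i j"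
    using prime_P primes_coprime by blast
  then obtain x where x: "\<forall>p\<in>P. [x = c p] (mod p)"
    using chinese_remainder_nat[of P "\<lambda>p. p" c] fin by auto
  define a0 where "a0 = x mod M"
  have "M > 0"
    unfolding M_def using fin prime_P by (simp add: prod_pos prime_gt_0_nat)
  then have a0_less: "a0 < M" by (simp add: a0_def)
  have dvd_M: "p dvd M" if "p \<in> P" for p
    unfolding M_def using dvd_prodI[of P p "\<lambda>p. p"] fin that by simp
  have a0: "[a0 + u * M = c p] (mod p)" if "p \<in> P" for p u
  proof -
    have "[a0 = x] (mod p)"
      using dvd_M[OF that] by (simp add: a0_def cong_def mod_mod_cancel)
    moreover have "[u * M = 0] (mod p)"
      using dvd_M[OF that] by (simp add: cong_0_iff)
    ultimately have "[a0 + u * M = x + 0] (mod p)"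
      by (rule cong_add)
    then have "[a0 + u * M = x] (mod p)"
      by simp
    with x that show ?thesis using cong_trans by blast
  qed
  let ?K = "{p. prime p \<and> p dvd k \<and> z < p}"
  have finK: "finite ?K"
    using finite_divisors_nat[of k] assms(1) by (auto intro: finite_subset)
  have not_dvd_M: "\<not> p dvd M" if pK: "p \<in> ?K" for p
  proof
    assume "p dvd M"
    then obtain q where q: "q \<in> P" "p dvd q"
      using pK fin prime_dvd_prod_iff[of P p "\<lambda>p. p"] by (auto simp: M_def)
    with pK prime_P have "p = q" using primes_dvd_imp_eq by blast
    with q pK assms(4) show False by (auto simp: P_def)
  qed
  have "\<exists>u\<in>{1..U}. \<forall>p\<in>?K. \<not> p dvd a0 + u * M"
    using finK _ sieve by (rule sieve_progression) (use not_dvd_M in blast)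
  then obtain u where "u \<in> {1..U}" and u: "\<And>p. p \<in> ?K \<Longrightarrow> \<not> p dvd a0 + u * M"
    by blast
  then have u_bounds: "1 \<le> u" "u \<le> U"
    by auto
  let ?a = "a0 + u * M"
  have a_ge: "?a \<ge> M" using mult_le_mono1[OF u_bounds(1), of M] by linarith
  show thesis
  proof (rule that[of ?a])
    show "0 < ?a" using a_ge \<open>M > 0\<close> by linarith
    have "?a < M + U * M" using a0_less u_bounds by (intro add_less_le_mono mult_le_mono1)
    also have "\<dots> = (U + 1) * M" by simp
    also have "\<dots> \<le> k" using size by (simp only: M)
    finally show "?a < k" .
    show "coprime ?a k"
    proof (rule ccontr)
      assume "\<not> coprime ?a k"
      then have "gcd ?a k \<noteq> 1"
        by (simp only: coprime_iff_gcd_eq_1 not_False_eq_True)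
      then obtain p where "prime p" "p dvd gcd ?a k"
        using prime_factor_nat by blast
      then have p: "prime p" "p dvd ?a" "p dvd k"
        using gcd_greatest_iff by blast+
      show False
      proof (cases "z < p")
        case True
        with p u[of p] show False by blast
      next
        case False
        then have "[?a = c p] (mod p)" using p(1) by (intro a0) (simp add: P_def)
        then have "[?a = 1] (mod p)" using p(3) by (simp add: c_def)
        then have "p dvd 1" using p(2) cong_dvd_iff by blast
        with p(1) show False by simp
      qed
    qed
    fix j assume "j < J"
    then obtain q where q: "q \<in> Q \<union> S" "j mod q = r q" using r by blast
    have qP: "q \<in> P" and qk: "\<not> q dvd k" and pq: "prime q"
      using q(1) assms(4) by (auto simp: P_def Q_def)
    have "[j = r q] (mod q)"
      using q(2)[symmetric] by (simp add: cong_def)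
    moreover have "[?a = (q - 1) * (r q * k)] (mod q)"
      using a0[OF qP, of u] qk by (simp add: c_def)
    ultimately have "[?a + j * k = (q - 1) * (r q * k) + r q * k] (mod q)"
      by (intro cong_add cong_mult cong_refl)
    also have "(q - 1) * (r q * k) + r q * k = q * (r q * k)"
      using prime_gt_0_nat[OF pq] by (cases q) auto
    finally have dvd: "q dvd ?a + j * k"
      by (metis cong_dvd_iff dvd_triv_left)
    \<comment> \<open>The divisor \<open>q\<close> must be a proper one. Since
      \<open>z >= 3\<close>, both 2 and 3 lie in \<open>P\<close>, so there is a second prime
      \<open>q'\<close> and \<open>q < q' * q <= M\<close>; and \<open>M <= ?a\<close> because
      \<open>u >= 1\<close>.\<close>
    obtain q' where q': "q' \<in> P" "q' \<noteq> q" "prime q'"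
    proof (cases "q = 2")
      case True
      then show ?thesis using that[of 3] assms(2) by (simp add: P_def)
    next
      case False
      then show ?thesis using that[of 2] assms(2) by (simp add: P_def)
    qed
    have "q' * q dvd M"
      using q' dvd_M qP pq by (intro divides_mult) (auto intro: primes_coprime)
    then have "q' * q \<le> M" using \<open>M > 0\<close> dvd_imp_le by blast
    moreover have "1 * q < q' * q"
      using q'(3) pq by (intro mult_less_mono1) (auto intro: prime_gt_1_nat prime_gt_0_nat simp del: One_nat_def)
    ultimately have "q < ?a + j * k" using a_ge by linarith
    with dvd pq show "\<not> prime (?a + j * k)"
      using primes_dvd_imp_eq[of q "?a + j * k"] by linarith
  qed
qed

subsection \<open>Chebyshev and Mertens estimates\<close>

abbreviation primes_le :: "nat \<Rightarrow> nat set" where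
  "primes_le n \<equiv> {p. prime p \<and> p \<le> n}"

lemma finite_primes_le [simp]: "finite (primes_le n)"
  by (rule finite_subset[of _ "{..n}"]) auto

section \<open>Legendre's formula for factorials\<close>

lemma sum_if_eq_card:
  assumes "finite A"
  shows "(\<Sum>j\<in>A. if P j then 1 else 0) = (card {j\<in>A. P j} :: nat)"
  using sum.inter_filter[OF assms, of "\<lambda>_. 1 :: nat" P] by simp

lemma multiplicity_eq_card:
  fixes p n m :: nat
  assumes "prime p" "0 < n" "n \<le> m"
  shows "multiplicity p n = card {j\<in>{1..m}. p ^ j dvd n}"
proof -
  have p: "\<not> is_unit p" using assms(1) by auto
  have "p ^ multiplicity p n \<le> n"
    using assms(2) by (intro dvd_imp_le multiplicity_dvd)
  moreover have "multiplicity p n < p ^ multiplicity p n"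
    using assms(1) by (intro power_gt_expt prime_gt_Suc_0_nat)
  ultimately have "multiplicity p n \<le> m"
    using assms(3) by linarith
  then have "{j\<in>{1..m}. p ^ j dvd n} = {1..multiplicity p n}"
    using assms(2) p by (auto simp: power_dvd_iff_le_multiplicity)
  then show ?thesis by simp
qed

text \<open>Legendre's formula: passing to \<open>Suc n\<close> raises \<open>n div p ^ j\<close> by
  one exactly when \<open>p ^ j\<close> divides \<open>Suc n\<close>. The cutoff \<open>m\<close> is
  kept apart from \<open>n\<close> so that the formulas for several factorials share one range of
  summation.\<close>

lemma multiplicity_fact:
  fixes p n m :: nat
  assumes "prime p" "n \<le> m"
  shows "multiplicity p (fact n) = (\<Sum>j=1..m. n div p ^ j)"
  using assms(2)
proof (induction n)
  case 0
  then show ?case by simp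
next
  case (Suc n)
  have "multiplicity p (fact (Suc n)) = multiplicity p (Suc n * fact n)"
    by simp
  also have "\<dots> = multiplicity p (Suc n) + multiplicity p (fact n)"
    using assms(1) by (subst prime_elem_multiplicity_mult_distrib) auto
  also have "multiplicity p (Suc n) = (\<Sum>j=1..m. if p ^ j dvd Suc n then 1 else 0)"
    using multiplicity_eq_card[OF assms(1) _ Suc.prems] by (subst sum_if_eq_card) simp_all
  also have "multiplicity p (fact n) = (\<Sum>j=1..m. n div p ^ j)"
    using Suc by simp
  also have "(\<Sum>j=1..m. if p ^ j dvd Suc n then 1 else 0) + (\<Sum>j=1..m. n div p ^ j)
      = (\<Sum>j=1..m. Suc n div p ^ j)"
    unfolding sum.distrib [symmetric]
    by (intro sum.cong) (auto simp: div_Suc dvd_eq_mod_eq_0)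
  finally show ?case .
qed

lemma ln_fact_eq_sum_primes:
  fixes n m :: nat
  assumes "n \<le> m"
  shows "ln (fact n) = (\<Sum>p\<in>primes_le m. (\<Sum>j=1..m. real (n div p ^ j)) * ln p)"
proof -
  have "p \<in> primes_le n" if "p \<in> prime_factors (fact n)" for p :: nat
    using that prime_dvd_fact_iff by auto
  then have "prime_factors (fact n :: nat) \<subseteq> primes_le m"
    using assms by fastforce
  moreover have "fact n = (\<Prod>p\<in>prime_factors (fact n :: nat). p ^ multiplicity p (fact n))"
    by (rule prime_factorization_nat) simp
  ultimately have "fact n = (\<Prod>p\<in>primes_le m. p ^ multiplicity p (fact n :: nat))"
    by (subst prod.mono_neutral_left[symmetric]) (auto simp: prime_factors_multiplicity)
  then have "ln (real (fact n)) = ln (\<Prod>p\<in>primes_le m. real p ^ multiplicity p (fact n :: nat))"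
    by (metis (no_types, lifting) of_nat_prod of_nat_power prod.cong)
  also have "\<dots> = (\<Sum>p\<in>primes_le m. ln (real p ^ multiplicity p (fact n :: nat)))"
    by (rule ln_prod) (auto simp: prime_gt_0_nat)
  also have "\<dots> = (\<Sum>p\<in>primes_le m. (\<Sum>j=1..m. real (n div p ^ j)) * ln p)"
    using assms by (intro sum.cong) (auto simp: ln_realpow prime_gt_0_nat multiplicity_fact)
  finally show ?thesis by simp
qed

section \<open>Elementary Stirling bounds\<close>

lemma ln_fact_Suc: "ln (fact (Suc n)) = ln (real n + 1) + ln (fact n :: real)"
proof -
  have "ln (fact (Suc n)) = ln ((real n + 1) * fact n)"
    by (simp add: add_ac)
  also have "\<dots> = ln (real n + 1) + ln (fact n)"
    by (rule ln_mult_pos) auto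
  finally show ?thesis .
qed

lemma ln_fact_ge: "ln (fact n) \<ge> real n * ln n - n"
proof (induction n)
  case (Suc n)
  show ?case
  proof (cases "n = 0")
    case False
    have "ln (1 + 1 / real n) \<le> 1 / real n"
      by (rule ln_add_one_self_le_self) simp
    also have "1 + 1 / real n = (n + 1) / n" using False by (simp add: field_simps)
    finally have "real n * (ln (real n + 1) - ln n) \<le> 1"
      using False by (simp add: ln_div field_simps)
    then show ?thesis
      using Suc False unfolding ln_fact_Suc by (simp add: algebra_simps)
  qed simp
qed simp

lemma ln_fact_le:
  assumes "n \<ge> 1"
  shows "ln (fact n) \<le> real n * ln n - n + ln n + 1"
  using assms
proof (induction n rule: dec_induct)
  case (step n)
  have "ln (real n / (n + 1)) \<le> real n / (n + 1) - 1"
    using step by (intro ln_le_minus_one) auto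
  then have "(real n + 1) * (ln (real n + 1) - ln n) \<ge> 1"
    using step by (simp add: ln_div field_simps)
  then show ?case
    using step unfolding ln_fact_Suc by (simp add: algebra_simps)
qed simp

text \<open>The derivative \<open>ln x\<close> is nonnegative from 1 on. This allows
  \<open>n div d\<close> to be compared with the real quotient \<open>n / d\<close> inside the
  Stirling bounds.\<close>

lemma xlnx_mono:
  fixes x y :: real
  assumes "1 \<le> x" "x \<le> y"
  shows "x * ln x - x \<le> y * ln y - y"
proof -
  have "ln (x / y) \<le> x / y - 1"
    using assms by (intro ln_le_minus_one) auto
  then have "y * ln y \<ge> y * ln x + y - x"
    using assms by (simp add: ln_div field_simps)
  moreover have "(y - x) * ln x \<ge> 0"
    using assms by simp
  ultimately show ?thesis by (simp add: algebra_simps)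
qed

lemma ln_fact_div_le:
  fixes n d :: nat
  assumes "1 \<le> d" "d \<le> n"
  shows "ln (fact (n div d)) \<le> (n / d) * ln (n / d) - n / d + ln n + 1"
proof -
  have 1: "n div d \<ge> 1" using assms div_le_mono[of d n d] by simp
  have le: "real (n div d) \<le> n / d" by (rule of_nat_div_le_of_nat)
  have "ln (fact (n div d)) \<le> real (n div d) * ln (real (n div d)) - real (n div d) + ln (real (n div d)) + 1"
    using 1 by (rule ln_fact_le)
  also have "\<dots> \<le> ((n / d) * ln (n / d) - n / d) + ln n + 1"
  proof (intro add_mono xlnx_mono)
    have "real (n div d) \<le> real n" by simp
    then show "ln (real (n div d)) \<le> ln (real n)"
      using 1 assms by (subst ln_le_cancel_iff) simp_all
  qed (use 1 le in auto)
  finally show ?thesis .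
qed

text \<open>Since \<open>n div d\<close> may lie below \<open>n / d\<close>, Stirling's lower bound
  is applied to \<open>n div d + 1\<close>; the additional factor of that factorial is at most
  \<open>n\<close> and costs \<open>ln n\<close>.\<close>

lemma ln_fact_div_ge:
  fixes n d :: nat
  assumes "2 \<le> d" "d \<le> n"
  shows "ln (fact (n div d)) \<ge> (n / d) * ln (n / d) - n / d - ln n"
proof -
  let ?m = "n div d"
  have "real n / d \<le> real (?m + 1)"
  proof -
    have "n = ?m * d + n mod d" by simp
    also have "\<dots> \<le> ?m * d + d" using assms by (intro add_left_mono less_imp_le mod_less_divisor) simp
    also have "\<dots> = (?m + 1) * d" by simp
    finally have "real n \<le> real (?m + 1) * real d" by (simp only: of_nat_mult [symmetric] of_nat_le_iff)
    then show ?thesis using assms by (simp add: divide_le_eq)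
  qed
  moreover have "1 \<le> real n / d" using assms by simp
  ultimately have "(n / d) * ln (n / d) - n / d \<le> real (?m + 1) * ln (real (?m + 1)) - real (?m + 1)"
    by (intro xlnx_mono)
  also have "\<dots> \<le> ln (fact (?m + 1))" by (rule ln_fact_ge)
  also have "\<dots> = ln (fact ?m) + ln (real ?m + 1)"
    by (simp add: ln_mult add_ac)
  also have "ln (real ?m + 1) \<le> ln n"
  proof -
    have "n div d \<le> n div 2" using assms by (intro div_le_mono2) auto
    then have "?m + 1 \<le> n" using assms by linarith
    then show ?thesis by simp
  qed
  finally show ?thesis by simp
qed

section \<open>Chebyshev's lower bounds\<close>

definition chebyshev_const :: real where
  "chebyshev_const = (14 * ln 2 + 9 * ln 3 + 5 * ln 5) / 30"

text \<open>As \<open>1 - 1/2 - 1/3 - 1/5 + 1/30 = 0\<close>, the combination of floors depends on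
  \<open>m mod 30\<close> only, which leaves thirty cases.\<close>

lemma chebyshev_floor_le:
  fixes m :: nat
  shows "m + m div 30 \<le> m div 2 + m div 3 + m div 5 + (if m \<ge> 1 then 1 else 0)"
proof -
  define q r where "q = m div 30" and "r = m mod 30"
  have m: "m = r + q * 30" and r: "r \<in> set [0..<30]" by (simp_all add: q_def r_def)
  have divs: "m div 2 = r div 2 + q * 15" "m div 3 = r div 3 + q * 10" "m div 5 = r div 5 + q * 6"
    "m div 30 = q"
    unfolding m using div_mult_self1[of 2 r "q * 15"] div_mult_self1[of 3 r "q * 10"]
      div_mult_self1[of 5 r "q * 6"] r by (simp_all add: mult.assoc)
  have "\<forall>r\<in>set [0..<30]. r \<le> r div 2 + r div 3 + r div 5 + 1"
    by (simp add: upt_rec)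
  with r have "r \<le> r div 2 + r div 3 + r div 5 + 1" by blast
  then have "m + m div 30 \<le> m div 2 + m div 3 + m div 5 + 1"
    unfolding divs m by simp
  then show ?thesis by (cases "m = 0") auto
qed

text \<open>The left side is Chebyshev's psi function. With \<open>T d\<close> the logarithm of the
  factorial of \<open>n div d\<close>, the combination \<open>T 1 - T 2 - T 3 - T 5 + T 30\<close>
  is at most psi, prime by prime and exponent by exponent; by Stirling its main term has the
  coefficient \<open>ln 2 / 2 + ln 3 / 3 + ln 5 / 5 - ln 30 / 30\<close>, which is
  \<open>chebyshev_const\<close>.\<close>

lemma chebyshev_sum_ge:
  fixes n :: nat
  assumes "n \<ge> 30"
  shows "(\<Sum>p\<in>primes_le n. card {j\<in>{1..n}. p ^ j \<le> n} * ln p)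
    \<ge> chebyshev_const * n - 5 * ln n - 3"
proof -
  let ?T = "\<lambda>d. ln (fact (n div d)) :: real"
  let ?F = "\<lambda>d p. (\<Sum>j=1..n. real (n div p ^ j div d)) * ln (real p)"
  have T: "?T d = (\<Sum>p\<in>primes_le n. ?F d p)" for d
    by (subst ln_fact_eq_sum_primes[of "n div d" n])
       (auto simp: div_mult2_eq[symmetric] mult.commute intro!: sum.cong)
  have F: "?F 1 p - ?F 2 p - ?F 3 p - ?F 5 p + ?F 30 p \<le> card {j\<in>{1..n}. p ^ j \<le> n} * ln p"
    if "p \<in> primes_le n" for p
  proof -
    have p: "p > 0" using that by (auto simp: prime_gt_0_nat)
    have "(\<Sum>j=1..n. n div p ^ j + n div p ^ j div 30)
       \<le> (\<Sum>j=1..n. n div p ^ j div 2 + n div p ^ j div 3 + n div p ^ j div 5 + (if n div p ^ j \<ge> 1 then 1 else 0))"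
      by (intro sum_mono chebyshev_floor_le)
    also have "\<dots> = (\<Sum>j=1..n. n div p ^ j div 2) + (\<Sum>j=1..n. n div p ^ j div 3)
        + (\<Sum>j=1..n. n div p ^ j div 5) + card {j\<in>{1..n}. p ^ j \<le> n}"
      using p by (simp add: sum.distrib sum_if_eq_card Suc_le_eq div_greater_zero_iff)
    finally have "real (\<Sum>j=1..n. n div p ^ j) + real (\<Sum>j=1..n. n div p ^ j div 30) \<le>
       real (\<Sum>j=1..n. n div p ^ j div 2) + real (\<Sum>j=1..n. n div p ^ j div 3)
        + real (\<Sum>j=1..n. n div p ^ j div 5) + real (card {j\<in>{1..n}. p ^ j \<le> n})"
      unfolding sum.distrib of_nat_add[symmetric] of_nat_le_iff .
    then have "((\<Sum>j=1..n. real (n div p ^ j div 1)) - (\<Sum>j=1..n. real (n div p ^ j div 2))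
       - (\<Sum>j=1..n. real (n div p ^ j div 3)) - (\<Sum>j=1..n. real (n div p ^ j div 5))
       + (\<Sum>j=1..n. real (n div p ^ j div 30))) * ln p \<le> card {j\<in>{1..n}. p ^ j \<le> n} * ln p"
      using p by (intro mult_right_mono) simp_all
    then show ?thesis by (simp add: algebra_simps)
  qed
  have n: "real n > 0" using assms by simp
  have ln_n: "ln (real n) \<ge> 0" using assms by (intro ln_ge_zero) simp
  \<comment> \<open>The terms \<open>n * ln n\<close> and \<open>n\<close> cancel, their
    coefficients being \<open>1 - 1/2 - 1/3 - 1/5 + 1/30\<close>. The Stirling errors amount to
    \<open>4 * ln n + 3\<close>; the final \<open>- ln n\<close> is slack, given up in the next
    step.\<close>
  have "chebyshev_const * n - 5 * ln n - 3
     = (real n * ln n - n) - ((n / 2) * ln (n / 2) - n / 2 + ln n + 1) - ((n / 3) * ln (n / 3) - n / 3 + ln n + 1)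
     - ((n / 5) * ln (n / 5) - n / 5 + ln n + 1) + ((n / 30) * ln (n / 30) - n / 30 - ln n) - ln n"
  proof -
    have "ln (30::real) = ln (2 * 3 * 5)" by simp
    also have "\<dots> = ln 2 + ln 3 + ln 5" by (simp only: ln_mult_pos)
    finally show ?thesis using n by (simp add: chebyshev_const_def ln_div field_simps)
  qed
  also have "\<dots> \<le> (real n * ln n - n) - ((n / 2) * ln (n / 2) - n / 2 + ln n + 1) - ((n / 3) * ln (n / 3) - n / 3 + ln n + 1)
     - ((n / 5) * ln (n / 5) - n / 5 + ln n + 1) + ((n / 30) * ln (n / 30) - n / 30 - ln n)"
    using ln_n by linarith
  also have "\<dots> \<le> ?T 1 - ?T 2 - ?T 3 - ?T 5 + ?T 30"
    using ln_fact_ge[of n] ln_fact_div_le[of 2 n] ln_fact_div_le[of 3 n] ln_fact_div_le[of 5 n]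
      ln_fact_div_ge[of 30 n] assms by simp
  also have "\<dots> = (\<Sum>p\<in>primes_le n. ?F 1 p - ?F 2 p - ?F 3 p - ?F 5 p + ?F 30 p)"
    unfolding T by (simp only: sum.distrib sum_subtractf)
  also have "\<dots> \<le> (\<Sum>p\<in>primes_le n. card {j\<in>{1..n}. p ^ j \<le> n} * ln p)"
    by (intro sum_mono F)
  finally show ?thesis .
qed

text \<open>If \<open>e\<close> positive exponents \<open>j\<close> satisfy
  \<open>p ^ j <= n\<close>, the largest of them is at least \<open>e\<close>, hence
  \<open>p ^ e <= n\<close>.\<close>

lemma card_powers_le:
  fixes p n :: nat
  assumes "prime p" "p \<le> n"
  shows "card {j\<in>{1..n}. p ^ j \<le> n} * ln p \<le> ln n"
proof -
  let ?S = "{j\<in>{1..n}. p ^ j \<le> n}"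
  have p: "p \<ge> 1" using assms(1) prime_gt_0_nat by (simp add: Suc_le_eq)
  have "1 \<in> ?S" using assms p by auto
  then have "Max ?S \<in> ?S" by (intro Max_in) auto
  then have "p ^ Max ?S \<le> n" by blast
  moreover have "card ?S \<le> card {1..Max ?S}"
    by (intro card_mono) auto
  then have "p ^ card ?S \<le> p ^ Max ?S"
    using p by (intro power_increasing) auto
  ultimately have "p ^ card ?S \<le> n"
    by linarith
  then have "real p ^ card ?S \<le> real n"
    by (simp only: of_nat_power [symmetric] of_nat_le_iff)
  then have "ln (real p ^ card ?S) \<le> ln n"
    using p assms(2) by (subst ln_le_cancel_iff) simp_all
  then show ?thesis using p by (simp add: ln_realpow)
qed

lemma chebyshev_card_primes_ge:
  assumes "n \<ge> 30"
  shows "card (primes_le n) * ln n \<ge> chebyshev_const * n - 5 * ln n - 3"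
proof -
  have "(\<Sum>p\<in>primes_le n. card {j\<in>{1..n}. p ^ j \<le> n} * ln p) \<le> (\<Sum>p\<in>primes_le n. ln n)"
    by (intro sum_mono card_powers_le) auto
  then show ?thesis using chebyshev_sum_ge[OF assms] by simp
qed

definition theta :: "nat \<Rightarrow> real" where
  "theta n = (\<Sum>p\<in>primes_le n. ln (real p))"

text \<open>Psi exceeds theta only through primes with \<open>p ^ 2 <= n\<close>; there are at most
  \<open>sqrt n\<close> of these, and each adds at most \<open>ln n\<close>.\<close>

lemma chebyshev_theta_ge:
  assumes "n \<ge> 30"
  shows "theta n \<ge> chebyshev_const * n - (5 + sqrt n) * ln n - 3"
proof -
  let ?A = "{p\<in>primes_le n. p ^ 2 \<le> n}"
  have "card {j\<in>{1..n}. p ^ j \<le> n} * ln p \<le> ln p + (if p ^ 2 \<le> n then ln n else 0)"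
    if "p \<in> primes_le n" for p
  proof (cases "p ^ 2 \<le> n")
    case True
    have "real p \<ge> 1" using that prime_ge_1_nat by auto
    then have "ln (real p) \<ge> 0" by (rule ln_ge_zero)
    with True show ?thesis using card_powers_le[of p n] that by simp
  next
    case False
    have "j = 1" if "j \<in> {1..n}" "p ^ j \<le> n" for j
    proof (rule ccontr)
      assume "j \<noteq> 1"
      then have "p ^ 2 \<le> p ^ j"
        using that \<open>p \<in> primes_le n\<close> by (intro power_increasing) (auto simp: Suc_le_eq prime_gt_0_nat)
      with that False show False by simp
    qed
    then have "{j\<in>{1..n}. p ^ j \<le> n} \<subseteq> {1}" by blast
    then have "card {j\<in>{1..n}. p ^ j \<le> n} \<le> 1"
      using card_mono[of "{1::nat}"] by fastforce
    then have "real (card {j\<in>{1..n}. p ^ j \<le> n}) * ln p \<le> 1 * ln p"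
      using that by (intro mult_right_mono) (auto simp: Suc_le_eq prime_gt_0_nat intro!: ln_ge_zero)
    with False show ?thesis by simp
  qed
  then have "(\<Sum>p\<in>primes_le n. card {j\<in>{1..n}. p ^ j \<le> n} * ln p)
     \<le> (\<Sum>p\<in>primes_le n. ln p + (if p ^ 2 \<le> n then ln n else 0))"
    by (rule sum_mono)
  also have "\<dots> = theta n + card ?A * ln n"
    by (simp only: theta_def sum.distrib sum.inter_filter [symmetric] finite_primes_le sum_constant)
  also have "card ?A * ln n \<le> sqrt n * ln n"
  proof (intro mult_right_mono)
    have "?A \<subseteq> {1..nat \<lfloor>sqrt n\<rfloor>}"
    proof
      fix p assume "p \<in> ?A"
      then have "real p ^ 2 \<le> n" "prime p" by (auto simp flip: of_nat_power)
      then have "real p \<le> sqrt n" by (intro real_le_rsqrt)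
      then show "p \<in> {1..nat \<lfloor>sqrt n\<rfloor>}"
        using \<open>prime p\<close> by (auto simp: le_nat_floor Suc_le_eq prime_gt_0_nat)
    qed
    then have "card ?A \<le> card {1..nat \<lfloor>sqrt n\<rfloor>}" by (intro card_mono) auto
    then have "card ?A \<le> nat \<lfloor>sqrt n\<rfloor>" by simp
    then have "real (card ?A) \<le> real (nat \<lfloor>sqrt n\<rfloor>)" by (rule of_nat_mono)
    also have "\<dots> \<le> sqrt n" by simp
    finally show "real (card ?A) \<le> sqrt n" .
  qed (use assms in auto)
  finally show ?thesis
    using chebyshev_sum_ge[OF assms] by (simp add: algebra_simps)
qed

section \<open>Chebyshev's upper bound for theta\<close>

lemma prod_primes_dvd:
  fixes n :: nat
  assumes "finite A" "\<And>p. p \<in> A \<Longrightarrow> prime p \<and> p dvd n"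
  shows "\<Prod>A dvd n"
  using assms
proof (induction A)
  case (insert p A)
  have "coprime p (\<Prod>A)"
    using insert by (intro prod_coprime_right) (metis insertI1 insertI2 primes_coprime)
  then show ?case using insert by (auto intro: divides_mult)
qed simp

text \<open>The two equal middle entries of row \<open>2 * m + 1\<close> together are at most the
  row sum \<open>2 * 4 ^ m\<close>.\<close>

lemma choose_le_4_power: "(2 * m + 1) choose m \<le> 4 ^ m"
proof -
  have "2 * ((2 * m + 1) choose m) = ((2 * m + 1) choose m) + ((2 * m + 1) choose (m + 1))"
    using binomial_symmetric[of m "2 * m + 1"] by simp
  also have "\<dots> = (\<Sum>k\<in>{m, m + 1}. (2 * m + 1) choose k)"
    by simp
  also have "\<dots> \<le> (\<Sum>k\<le>2 * m + 1. (2 * m + 1) choose k)"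
    by (intro sum_mono2) auto
  also have "\<dots> = 2 * 4 ^ m"
    unfolding choose_row_sum by (simp add: power_mult)
  finally show ?thesis by simp
qed

text \<open>Erdos's induction: an even \<open>n > 2\<close> adds no prime, and for
  \<open>n = 2 * m + 1\<close> the primes in \<open>(m + 1, n]\<close> all divide
  \<open>n choose m\<close>, so their product is at most \<open>4 ^ m\<close>.\<close>

lemma theta_le: "theta n \<le> n * ln 4"
proof (induction n rule: less_induct)
  case (less n)
  consider "n \<le> 1" | "n = 2" | "n > 2" "even n" | m where "n = 2 * m + 1" "m \<ge> 1"
  proof (cases "even n")
    case True
    then show thesis using that(1-3) by linarith
  next
    case False
    then obtain m where "n = 2 * m + 1" by (elim oddE)
    then show thesis using that(1) that(4)[of m] by (cases "m = 0") auto
  qed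
  then show ?case
  proof cases
    case 1
    then have "primes_le n = {}" by (auto dest!: prime_ge_2_nat)
    then have "theta n = 0" unfolding theta_def by (simp only: sum.empty)
    then show ?thesis by simp
  next
    case 2
    have "primes_le 2 = {2}" using prime_ge_2_nat by (auto intro: antisym)
    then have "theta n = ln 2" using 2 by (simp add: theta_def)
    also have "\<dots> \<le> 1 * ln 4" by simp
    also have "\<dots> \<le> real n * ln 4" using 2 by (intro mult_right_mono) simp_all
    finally show ?thesis .
  next
    case 3
    then have "\<not> prime n" using prime_odd_nat by blast
    then have "p \<le> n \<longleftrightarrow> p \<le> n - 1" if "prime p" for p
      using that 3 by (cases "p = n") auto
    then have "primes_le n = primes_le (n - 1)" by blast
    then have "theta n = theta (n - 1)" by (simp add: theta_def)
    also have "\<dots> \<le> real (n - 1) * ln 4" using 3 by (intro less.IH) auto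
    also have "\<dots> \<le> real n * ln 4" by (intro mult_right_mono) auto
    finally show ?thesis .
  next
    case (4 m)
    let ?D = "{p. prime p \<and> m + 1 < p \<and> p \<le> n}"
    have fin: "finite ?D" by (rule finite_subset[of _ "{..n}"]) auto
    have "p dvd n choose m" if "p \<in> ?D" for p
    proof -
      have "fact m * fact (n - m) * (n choose m) = (fact n :: nat)"
        using 4 by (intro binomial_fact_lemma) auto
      moreover have "p dvd fact n" "\<not> p dvd fact m" "\<not> p dvd fact (n - m)"
      proof -
        have "m < p" "n - m < p" using that 4 by auto
        then show "p dvd fact n" "\<not> p dvd fact m" "\<not> p dvd fact (n - m)"
          using that by (simp_all add: prime_dvd_fact_iff)
      qed
      ultimately show ?thesis using that by (metis (no_types, lifting) mem_Collect_eq prime_dvd_mult_iff)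
    qed
    then have "\<Prod>?D dvd n choose m"
      using fin by (intro prod_primes_dvd) auto
    then have "\<Prod>?D \<le> n choose m"
      using 4 by (intro dvd_imp_le) auto
    also have "\<dots> \<le> 4 ^ m"
      using choose_le_4_power 4 by simp
    finally have "real (\<Prod>?D) \<le> 4 ^ m"
      by (metis of_nat_le_iff of_nat_numeral of_nat_power)
    moreover have "real (\<Prod>?D) > 0"
      unfolding of_nat_prod by (intro prod_pos) (auto simp: prime_gt_0_nat)
    ultimately have "ln (real (\<Prod>?D)) \<le> ln (4 ^ m)"
      by (subst ln_le_cancel_iff) auto
    also have "\<dots> = m * ln 4" by (simp add: ln_realpow)
    also have "ln (real (\<Prod>?D)) = (\<Sum>p\<in>?D. ln (real p))"
      unfolding of_nat_prod using fin by (subst ln_prod) (auto simp: prime_gt_0_nat)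
    finally have D: "(\<Sum>p\<in>?D. ln (real p)) \<le> m * ln 4" .
    have "primes_le n = primes_le (m + 1) \<union> ?D" using 4 by auto
    then have "theta n = theta (m + 1) + (\<Sum>p\<in>?D. ln (real p))"
      unfolding theta_def using fin by (subst sum.union_disjoint[symmetric]) auto
    also have "\<dots> \<le> real (m + 1) * ln 4 + m * ln 4"
      using 4 by (intro add_mono less.IH D) auto
    also have "\<dots> = n * ln 4" using 4 by (simp add: algebra_simps)
    finally show ?thesis .
  qed
qed

section \<open>Mertens' first theorem with explicit constants\<close>

lemma sum_inverse_powers:
  fixes x :: real
  assumes "x > 1"
  shows "(\<Sum>j=1..m. 1 / x ^ j) = (1 - 1 / x ^ m) / (x - 1)"
proof (induction m)
  case (Suc m)
  have "(1 - 1 / x ^ m) / (x - 1) + 1 / x ^ Suc m = (1 - 1 / x ^ Suc m) / (x - 1)"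
    using assms by (simp add: field_simps)
  with Suc show ?case by simp
qed simp

lemma sum_floor_powers_le:
  fixes p n m :: nat
  assumes "p \<ge> 2"
  shows "(\<Sum>j=1..m. real (n div p ^ j)) \<le> n / (real p - 1)"
proof -
  have "(\<Sum>j=1..m. real (n div p ^ j)) \<le> (\<Sum>j=1..m. real n / real (p ^ j))"
    by (intro sum_mono of_nat_div_le_of_nat)
  also have "\<dots> = n * (\<Sum>j=1..m. 1 / real p ^ j)"
    by (simp add: sum_distrib_left)
  also have "\<dots> = n * ((1 - 1 / real p ^ m) / (real p - 1))"
    using assms by (subst sum_inverse_powers) auto
  also have "\<dots> \<le> n * (1 / (real p - 1))"
    using assms by (intro mult_left_mono divide_right_mono) auto
  finally show ?thesis by simp
qed

lemma real_div_minus_one_le: "real n / real d - 1 \<le> real (n div d)"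
proof -
  have "real n / real d - 1 < of_int \<lfloor>real n / real d\<rfloor>" by linarith
  also have "\<lfloor>real n / real d\<rfloor> = int (n div d)" by (rule floor_divide_of_nat_eq)
  finally show ?thesis by simp
qed

text \<open>Let \<open>p ^ e\<close> be the largest power of \<open>p\<close> up to
  \<open>n\<close>. Cutting the geometric series at \<open>e\<close> loses at most 2, and the floors
  lose at most 1 each, in total \<open>e * ln p <= ln n\<close> after weighting.\<close>

lemma sum_floor_powers_ge:
  fixes p n :: nat
  assumes "p \<ge> 2" "n \<ge> 1"
  shows "(\<Sum>j=1..n. real (n div p ^ j)) * ln p \<ge> n * (ln p / (real p - 1)) - ln n - 2 * ln p"
proof -
  obtain e where e: "p ^ e \<le> n" "n < p ^ (e + 1)"
    using ex_power_ivl1[OF assms] by blast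
  have "e < p ^ e" using assms by (intro power_gt_expt) auto
  then have "e \<le> n" using e by linarith
  have pe: "real p ^ e \<le> n" using e(1) by (simp only: of_nat_power [symmetric] of_nat_le_iff)
  have "real n < real (p ^ (e + 1))" using e(2) by (simp only: of_nat_less_iff)
  then have "n / real p ^ e \<le> p"
    using assms by (simp add: divide_le_eq mult.commute)
  also have "\<dots> \<le> 2 * (real p - 1)" using assms by simp
  finally have "n / real p ^ e / (real p - 1) \<le> 2"
    using pos_divide_le_eq[of "real p - 1" "n / real p ^ e" 2] assms by linarith
  moreover have "n * ((1 - 1 / real p ^ e) / (real p - 1)) = n / (real p - 1) - n / real p ^ e / (real p - 1)"
    by (simp add: diff_divide_distrib right_diff_distrib)
  ultimately have "n / (real p - 1) - 2 - e \<le> n * ((1 - 1 / real p ^ e) / (real p - 1)) - e"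
    by linarith
  also have "\<dots> = n * (\<Sum>j=1..e. 1 / real p ^ j) - e"
    using assms by (subst sum_inverse_powers) auto
  also have "\<dots> = (\<Sum>j=1..e. real n / real (p ^ j) - 1)"
    by (simp add: sum_subtractf sum_distrib_left)
  also have "\<dots> \<le> (\<Sum>j=1..e. real (n div p ^ j))"
    by (intro sum_mono real_div_minus_one_le)
  also have "\<dots> \<le> (\<Sum>j=1..n. real (n div p ^ j))"
    using \<open>e \<le> n\<close> by (intro sum_mono2) auto
  finally have "(n / (real p - 1) - 2 - e) * ln p \<le> (\<Sum>j=1..n. real (n div p ^ j)) * ln p"
    using assms by (intro mult_right_mono) auto
  moreover have "ln (real p ^ e) \<le> ln n"
    using pe assms by (subst ln_le_cancel_iff) auto
  then have "e * ln p \<le> ln n"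
    using assms by (simp add: ln_realpow)
  ultimately show ?thesis by (simp add: algebra_simps)
qed

text \<open>The denominator \<open>p - 1\<close> accounts for all powers of \<open>p\<close> at
  once, so Legendre's formula and \<open>n * ln n - n <= ln (fact n)\<close> give the bound
  directly.\<close>

lemma sum_ln_over_pred_ge:
  assumes "n \<ge> 1"
  shows "(\<Sum>p\<in>primes_le n. ln p / (real p - 1)) \<ge> ln n - 1"
proof -
  have "n * ln n - n \<le> ln (fact n)" by (rule ln_fact_ge)
  also have "\<dots> = (\<Sum>p\<in>primes_le n. (\<Sum>j=1..n. real (n div p ^ j)) * ln p)"
    by (rule ln_fact_eq_sum_primes) simp
  also have "\<dots> \<le> (\<Sum>p\<in>primes_le n. n / (real p - 1) * ln p)"
    by (intro sum_mono mult_right_mono sum_floor_powers_le)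
       (auto intro: prime_ge_2_nat ln_ge_zero simp: Suc_le_eq prime_gt_0_nat)
  also have "\<dots> = n * (\<Sum>p\<in>primes_le n. ln p / (real p - 1))"
    by (simp add: sum_distrib_left)
  finally have "n * (ln n - 1) \<le> n * (\<Sum>p\<in>primes_le n. ln p / (real p - 1))"
    by (simp add: algebra_simps)
  then show ?thesis using assms by (simp add: mult_le_cancel_left_pos)
qed

text \<open>The upper Stirling bound for \<open>X\<close> is split at \<open>z\<close>. Primes up to
  \<open>z\<close> contribute at least their expected share, minus \<open>3 * ln X\<close> each. For
  the primes beyond \<open>z\<close>, the floor errors add up to at most \<open>theta X\<close>,
  hence to at most \<open>X * ln 4\<close>.\<close>

lemma sum_ln_over_prime_between:
  fixes z X :: nat
  assumes "2 \<le> z" "z \<le> X"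
  shows "(\<Sum>p | prime p \<and> z < p \<and> p \<le> X. ln p / p)
    \<le> ln X - ln z + ln 4 + (ln X + 1 + 3 * card (primes_le z) * ln X) / X"
proof -
  let ?D = "{p. prime p \<and> z < p \<and> p \<le> X}"
  let ?v = "\<lambda>p. (\<Sum>j=1..X. real (X div p ^ j))"
  have fin: "finite ?D" by (rule finite_subset[of _ "{..X}"]) auto
  have U: "primes_le X = primes_le z \<union> ?D" using assms by auto
  have X: "real X > 0" "X \<ge> 1" using assms by auto
  have "X * (ln z - 1) - 3 * card (primes_le z) * ln X
      \<le> X * (\<Sum>p\<in>primes_le z. ln p / (real p - 1)) - (\<Sum>p\<in>primes_le z. 3 * ln X)"
    using sum_ln_over_pred_ge[of z] assms by (intro diff_mono mult_left_mono) auto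
  also have "\<dots> = (\<Sum>p\<in>primes_le z. X * (ln p / (real p - 1)) - 3 * ln X)"
    by (simp add: sum_subtractf sum_distrib_left)
  also have "\<dots> \<le> (\<Sum>p\<in>primes_le z. ?v p * ln p)"
  proof (intro sum_mono)
    fix p assume p: "p \<in> primes_le z"
    then have p2: "p \<ge> 2" by (simp add: prime_ge_2_nat)
    have "ln (real p) \<le> ln (real X)"
      using p p2 assms by (subst ln_le_cancel_iff) auto
    with sum_floor_powers_ge[OF p2 X(2)]
    show "X * (ln p / (real p - 1)) - 3 * ln X \<le> ?v p * ln p" by linarith
  qed
  finally have 1: "X * (ln z - 1) - 3 * card (primes_le z) * ln X \<le> (\<Sum>p\<in>primes_le z. ?v p * ln p)" .
  have "X * (\<Sum>p\<in>?D. ln p / p) - theta X \<le> X * (\<Sum>p\<in>?D. ln p / p) - (\<Sum>p\<in>?D. ln p)"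
    unfolding theta_def
    by (intro diff_left_mono sum_mono2) (auto intro!: ln_ge_zero simp: Suc_le_eq prime_gt_0_nat)
  also have "\<dots> = (\<Sum>p\<in>?D. (real X / p - 1) * ln p)"
    by (simp add: sum_distrib_left sum_subtractf algebra_simps)
  also have "\<dots> \<le> (\<Sum>p\<in>?D. ?v p * ln p)"
  proof (intro sum_mono mult_right_mono)
    fix p assume p: "p \<in> ?D"
    have "real X / p - 1 \<le> real (X div p)"
      by (rule real_div_minus_one_le)
    also have "\<dots> = (\<Sum>j\<in>{1}. real (X div p ^ j))" by simp
    also have "\<dots> \<le> ?v p" using X by (intro sum_mono2) auto
    finally show "real X / p - 1 \<le> ?v p" .
    show "ln (real p) \<ge> 0" using p by (auto intro!: ln_ge_zero simp: Suc_le_eq prime_gt_0_nat)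
  qed
  finally have 2: "X * (\<Sum>p\<in>?D. ln p / p) - theta X \<le> (\<Sum>p\<in>?D. ?v p * ln p)" .
  have "(\<Sum>p\<in>primes_le z. ?v p * ln p) + (\<Sum>p\<in>?D. ?v p * ln p) = (\<Sum>p\<in>primes_le X. ?v p * ln p)"
    unfolding U using fin by (subst sum.union_disjoint) auto
  also have "\<dots> = ln (fact X)" by (rule ln_fact_eq_sum_primes[symmetric]) simp
  also have "\<dots> \<le> X * ln X - X + ln X + 1" using X(2) by (rule ln_fact_le)
  finally have "X * (\<Sum>p\<in>?D. ln p / p)
      \<le> X * (ln X - ln z + ln 4) + (ln X + 1 + 3 * card (primes_le z) * ln X)"
    using 1 2 theta_le[of X] by (simp add: algebra_simps)
  also have "\<dots> = X * (ln X - ln z + ln 4 + (ln X + 1 + 3 * card (primes_le z) * ln X) / X)"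
    using X by (simp add: field_simps)
  finally show ?thesis using X by (simp add: mult_le_cancel_left_pos)
qed

lemma card_primes_le_le:
  assumes "z \<ge> 1"
  shows "2 * card (primes_le z) \<le> z + 1"
proof -
  have "p \<in> insert 2 ((\<lambda>i. 2 * i + 1) ` {1..(z - 1) div 2})" if "p \<in> primes_le z" for p
  proof (cases "p = 2")
    case False
    with that have "odd p" "p > 2"
      using prime_odd_nat[of p] prime_ge_2_nat[of p] by auto
    then obtain i where "p = 2 * i + 1" by (elim oddE)
    with that \<open>p > 2\<close> show ?thesis by auto
  qed simp
  then have "card (primes_le z) \<le> card (insert 2 ((\<lambda>i. 2 * i + 1) ` {1..(z - 1) div 2}))"
    by (intro card_mono) auto
  also have "\<dots> \<le> Suc (card ((\<lambda>i. 2 * i + 1) ` {1..(z - 1) div 2}))"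
    by (rule card_insert_le_m1) auto
  also have "\<dots> \<le> Suc (card {1..(z - 1) div 2})"
    by (intro Suc_leI le_imp_less_Suc card_image_le) auto
  finally have "card (primes_le z) \<le> Suc ((z - 1) div 2)" by simp
  then show ?thesis using assms by linarith
qed

section \<open>Partial summation and the Mertens product\<close>

lemma abel_lnln:
  fixes a :: "nat \<Rightarrow> real"
  assumes "z \<ge> 2" and lower: "\<And>N. N \<ge> z \<Longrightarrow> (\<Sum>n\<in>{z<..N}. a n) \<ge> ln (N + 1) - c"
    and "N \<ge> z"
  shows "(\<Sum>n\<in>{z<..N}. a n / ln n) \<ge> ln (ln (N + 1)) - ln (ln (z + 1)) + 1 - c / ln (z + 1)"
proof -
  define A where "A = (\<lambda>N. \<Sum>n\<in>{z<..N}. a n)"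
  \<comment> \<open>Partial summation as an induction: with the boundary term
    \<open>A N / ln (N + 1)\<close> subtracted, the step to \<open>Suc N\<close> adds
    \<open>A (Suc N) * (1 / l1 - 1 / l2)\<close>, to which the hypothesis \<open>lower\<close>
    applies.\<close>
  have "(\<Sum>n\<in>{z<..N}. a n / ln n) - A N / ln (N + 1)
     \<ge> ln (ln (N + 1)) - ln (ln (z + 1)) - c * (1 / ln (z + 1) - 1 / ln (N + 1))"
    using assms(3)
  proof (induction N rule: dec_induct)
    case base
    then show ?case by (simp add: A_def)
  next
    case (step N)
    define l0 l1 l2 where "l0 = ln (real z + 1)" and "l1 = ln (real N + 1)" and "l2 = ln (real N + 2)"
    have l: "0 < l1" "l1 < l2" using step assms(1) by (auto simp: l1_def l2_def)
    have suc: "real (Suc N) = real N + 1" "real (Suc N) + 1 = real N + 2" by simp_all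
    have ins: "{z<..Suc N} = insert (Suc N) {z<..N}" using step by auto
    have A: "A (Suc N) = A N + a (Suc N)" by (simp add: A_def ins)
    have "A (Suc N) \<ge> l2 - c"
      using lower[of "Suc N"] step unfolding suc by (simp add: A_def l2_def add_ac)
    then have "A (Suc N) * (1 / l1 - 1 / l2) \<ge> (l2 - c) * (1 / l1 - 1 / l2)"
      using l by (intro mult_right_mono) (auto simp: field_simps)
    moreover have "(l2 - c) * (1 / l1 - 1 / l2) = l2 * (1 / l1 - 1 / l2) - c * (1 / l1) + c * (1 / l2)"
      by (simp add: left_diff_distrib right_diff_distrib del: times_divide_eq_right)
    \<comment> \<open>The discrete substitute for integrating \<open>1 / (x * ln x)\<close>.\<close>
    moreover have "ln l2 - ln l1 \<le> l2 * (1 / l1 - 1 / l2)"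
    proof -
      have "ln (l2 / l1) \<le> l2 / l1 - 1" using l by (intro ln_le_minus_one) auto
      also have "l2 / l1 - 1 = l2 * (1 / l1 - 1 / l2)"
        using l by (simp add: field_simps)
      finally show ?thesis using l by (simp add: ln_div)
    qed
    moreover have "(\<Sum>n\<in>{z<..N}. a n / ln n) - A N / l1 \<ge> ln l1 - ln l0 - (c * (1 / l0) - c * (1 / l1))"
      using step.IH unfolding l0_def l1_def by (simp add: right_diff_distrib add_ac)
    moreover have "(\<Sum>n\<in>{z<..Suc N}. a n / ln n) - A (Suc N) / l2
        = ((\<Sum>n\<in>{z<..N}. a n / ln n) - A N / l1) + A (Suc N) * (1 / l1 - 1 / l2)"
      unfolding ins A by (simp add: l1_def add_divide_distrib algebra_simps)
    ultimately have "(\<Sum>n\<in>{z<..Suc N}. a n / ln n) - A (Suc N) / l2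
        \<ge> ln l2 - ln l0 - (c * (1 / l0) - c * (1 / l2))"
      by linarith
    then show ?case unfolding suc(2) l0_def l2_def by (simp add: right_diff_distrib add_ac)
  qed
  moreover have "A N / ln (N + 1) \<ge> (ln (N + 1) - c) / ln (N + 1)"
    using lower[OF assms(3)] unfolding A_def by (intro divide_right_mono) (auto simp: add_ac)
  moreover have "(ln (N + 1) - c) / ln (N + 1) = 1 - c / ln (N + 1)"
    using assms by (simp add: diff_divide_distrib)
  ultimately show ?thesis by (simp add: algebra_simps)
qed

definition mertens_prod :: "nat \<Rightarrow> real" where
  "mertens_prod n = (\<Prod>p\<in>primes_le n. 1 - 1 / real p)"

lemma sum_recip_consecutive:
  fixes z N :: nat
  assumes "1 \<le> z" "z \<le> N"
  shows "(\<Sum>n\<in>{z<..N}. 1 / (real n * (real n - 1))) = 1 / z - 1 / N"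
  using assms(2)
proof (induction N rule: dec_induct)
  case (step N)
  have "{z<..Suc N} = insert (Suc N) {z<..N}" using step by auto
  then have "(\<Sum>n\<in>{z<..Suc N}. 1 / (real n * (real n - 1)))
      = 1 / ((real N + 1) * N) + (1 / z - 1 / N)"
    using step by (simp add: add_ac)
  also have "1 / ((real N + 1) * N) = 1 / N - 1 / (real N + 1)"
    using step(1) assms(1) by (simp add: field_simps)
  also have "1 / N - 1 / (real N + 1) + (1 / z - 1 / N) = 1 / z - 1 / Suc N"
    by (simp add: add_ac)
  finally show ?case .
qed simp

text \<open>Beyond \<open>z\<close>, use \<open>1 - 1 / p <= exp (- 1 / p)\<close> and partial
  summation of \<open>ln p / (p - 1)\<close>. In \<open>1 + E + 1 / z\<close>, the 1 comes from
  Mertens' lower bound, \<open>E\<close> removes the primes up to \<open>z\<close>, and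
  \<open>1 / z\<close> pays for \<open>ln (N + 1)\<close> instead of \<open>ln N\<close>. The last
  \<open>1 / z\<close> bounds the telescoping sum of \<open>1 / (p - 1) - 1 / p\<close>.\<close>

lemma mertens_prod_le:
  assumes "z \<ge> 2" "N \<ge> z" and E: "(\<Sum>p\<in>primes_le z. ln p / (real p - 1)) \<le> E"
  shows "mertens_prod N \<le> mertens_prod z * ln (z + 1) * exp ((1 + E + 1 / z) / ln (z + 1) - 1 + 1 / z) / ln (N + 1)"
proof -
  let ?D = "\<lambda>N. {p. prime p \<and> z < p \<and> p \<le> N}"
  let ?a = "\<lambda>n::nat. if prime n then ln n / (real n - 1) else 0"
  have fin: "finite (?D N)" for N by (rule finite_subset[of _ "{..N}"]) auto
  have U: "primes_le N = primes_le z \<union> ?D N" if "N \<ge> z" for N using that by auto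
  have filt: "(\<Sum>n\<in>{z<..N}. if prime n then f n else 0) = (\<Sum>n\<in>?D N. f n)" for f :: "nat \<Rightarrow> real" and N
    by (subst sum.inter_filter[symmetric]) (auto intro!: sum.cong)
  have lower: "(\<Sum>n\<in>{z<..N}. ?a n) \<ge> ln (N + 1) - (1 + E + 1 / z)" if "N \<ge> z" for N
  proof -
    have "ln N - 1 \<le> (\<Sum>p\<in>primes_le N. ln p / (real p - 1))"
      using that assms(1) by (intro sum_ln_over_pred_ge) auto
    also have "\<dots> = (\<Sum>p\<in>primes_le z. ln p / (real p - 1)) + (\<Sum>p\<in>?D N. ln p / (real p - 1))"
      unfolding U[OF that] using fin by (subst sum.union_disjoint) auto
    finally have *: "(\<Sum>n\<in>{z<..N}. ?a n) \<ge> ln N - 1 - E"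
      using E unfolding filt by linarith
    have "ln (1 + 1 / real N) \<le> 1 / real N" by (rule ln_add_one_self_le_self) simp
    also have "1 + 1 / real N = (N + 1) / N" using assms that by (simp add: field_simps)
    finally have "ln (real N + 1) - ln N \<le> 1 / N" using assms that by (simp add: ln_div add_ac)
    moreover have "1 / real N \<le> 1 / z" using that assms by (simp add: frac_le)
    ultimately show ?thesis using * by (simp add: add_ac)
  qed
  have "ln (ln (N + 1)) - ln (ln (z + 1)) + 1 - (1 + E + 1 / z) / ln (z + 1) \<le> (\<Sum>n\<in>{z<..N}. ?a n / ln n)"
    using abel_lnln[where a = ?a, OF assms(1) lower assms(2)] by (simp add: add_ac)
  also have "\<dots> = (\<Sum>n\<in>{z<..N}. if prime n then 1 / (real n - 1) else 0)"
    by (intro sum.cong) (use assms in auto)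
  also have "\<dots> = (\<Sum>p\<in>?D N. 1 / (real p - 1))" by (rule filt)
  also have "\<dots> \<le> (\<Sum>p\<in>?D N. 1 / p + 1 / (real p * (real p - 1)))"
    using assms by (intro sum_mono) (auto simp: field_simps)
  also have "\<dots> = (\<Sum>p\<in>?D N. 1 / p) + (\<Sum>p\<in>?D N. 1 / (real p * (real p - 1)))"
    by (rule sum.distrib)
  also have "(\<Sum>p\<in>?D N. 1 / (real p * (real p - 1))) \<le> (\<Sum>n\<in>{z<..N}. 1 / (real n * (real n - 1)))"
    by (intro sum_mono2) auto
  also have "\<dots> \<le> 1 / z" using assms by (subst sum_recip_consecutive) auto
  finally have S: "ln (ln (z + 1)) - ln (ln (N + 1)) + ((1 + E + 1 / z) / ln (z + 1) - 1 + 1 / z) \<ge> - (\<Sum>p\<in>?D N. 1 / p)"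
    by linarith
  have pos: "mertens_prod z \<ge> 0"
    unfolding mertens_prod_def by (intro prod_nonneg) (auto simp: field_simps Suc_le_eq prime_gt_0_nat)
  have "(\<Prod>p\<in>?D N. 1 - 1 / real p) \<le> (\<Prod>p\<in>?D N. exp (- (1 / p)))"
  proof (intro prod_mono conjI)
    fix p assume "p \<in> ?D N"
    then show "0 \<le> 1 - 1 / real p" by (auto simp: field_simps Suc_le_eq prime_gt_0_nat)
    show "1 - 1 / real p \<le> exp (- (1 / real p))"
      using exp_ge_add_one_self[of "- (1 / real p)"] by simp
  qed
  also have "\<dots> = exp (- (\<Sum>p\<in>?D N. 1 / p))"
    unfolding sum_negf [symmetric] using fin by (rule exp_sum [symmetric])
  also have "\<dots> \<le> exp (ln (ln (z + 1)) - ln (ln (N + 1)) + ((1 + E + 1 / z) / ln (z + 1) - 1 + 1 / z))"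
    using S by simp
  also have "\<dots> = ln (z + 1) / ln (N + 1) * exp ((1 + E + 1 / z) / ln (z + 1) - 1 + 1 / z)"
    using assms by (simp add: exp_add exp_diff)
  finally have tail: "(\<Prod>p\<in>?D N. 1 - 1 / real p)
      \<le> ln (z + 1) / ln (N + 1) * exp ((1 + E + 1 / z) / ln (z + 1) - 1 + 1 / z)" .
  have "mertens_prod N = mertens_prod z * (\<Prod>p\<in>?D N. 1 - 1 / real p)"
    unfolding mertens_prod_def U[OF assms(2)] using fin by (intro prod.union_disjoint) auto
  also have "\<dots> \<le> mertens_prod z * (ln (z + 1) / ln (N + 1) * exp ((1 + E + 1 / z) / ln (z + 1) - 1 + 1 / z))"
    by (intro mult_left_mono tail pos)
  finally show ?thesis by (simp add: ac_simps)
qed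

subsection \<open>Sums and products over the primes up to 4000\<close>

primrec trial_by :: "int list \<Rightarrow> int \<Rightarrow> bool" where
  "trial_by [] m = True"
| "trial_by (d # ds) m = (if m mod d = 0 then m = d else trial_by ds m)"

definition trial :: "int \<Rightarrow> bool" where
  "trial = trial_by [2,3,5,7,11,13,17,19,23,29,31,37,41,43,47,53,59,61]"

text \<open>Doubles \<open>c\<close> until it reaches \<open>m\<close>, counting the doublings in
  \<open>b\<close>; the test \<open>c <= 0\<close> ensures that every doubling is an
  increase.\<close>

function bump :: "int \<Rightarrow> int \<Rightarrow> int \<Rightarrow> int \<times> int" where
  "bump m c b = (if m \<le> c \<or> c \<le> 0 then (c, b) else bump m (2 * c) (b + 1))"
  by auto
termination by (relation "measure (\<lambda>(m, c, b). nat (m - c))") auto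

declare bump.simps [simp del]

text \<open>
  Logarithms of primes are bounded through \<open>p ^ 8 \<le> 2 ^ b\<close>, hence \<open>ln p \<le> b * (ln 2 / 8)\<close>; the least
  such \<open>b\<close> is carried along with \<open>c = 2 ^ b\<close>, and all divisions are rounded outward.
\<close>

definition step :: "int \<Rightarrow> int \<times> int \<times> int \<times> int \<times> int \<times> int \<Rightarrow> int \<times> int \<times> int \<times> int \<times> int \<times> int" where
  "step m = (\<lambda>(c, b, w, t, e, r).
     if trial m then
       (case bump (m ^ 8) c b of (c', b') \<Rightarrow>
         (c', b', w - w div m, t + b', e + b' * 1000000 div (m - 1) + 1, r + 1))
     else (c, b, w, t, e, r))"

definition state_inv :: "nat \<Rightarrow> int \<times> int \<times> int \<times> int \<times> int \<times> int \<Rightarrow> bool" where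
  "state_inv n = (\<lambda>(c, b, w, t, e, r). 0 \<le> b \<and> c = 2 ^ nat b \<and> 0 \<le> w
     \<and> mertens_prod n \<le> w / 10 ^ 9
     \<and> theta n \<le> t * (ln 2 / 8)
     \<and> (\<Sum>p\<in>primes_le n. ln p / (real p - 1)) \<le> e / 10 ^ 6 * (ln 2 / 8)
     \<and> r = int (card (primes_le n)))"

lemma trial_by_prime:
  assumes "prime m" "\<And>d. d \<in> set ds \<Longrightarrow> d > 1"
  shows "trial_by ds m"
  using assms(2)
proof (induction ds)
  case (Cons d ds)
  have "m = d" if "m mod d = 0"
  proof -
    have "0 \<le> d \<and> d dvd m \<longrightarrow> d = 1 \<or> d = m"
      using assms(1) unfolding prime_int_iff by blast
    then show ?thesis using that Cons.prems[of d] by (auto simp: mod_eq_0_iff_dvd)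
  qed
  with Cons show ?case by auto
qed simp

text \<open>The first entry of the list dividing \<open>m\<close> decides the outcome, and it
  accepts only if it equals \<open>m\<close>.\<close>

lemma trial_by_dvd:
  assumes "trial_by ds m" "d \<in> set ds" "d dvd m"
  shows "m \<in> set ds"
  using assms by (induction ds) (auto split: if_splits simp: mod_eq_0_iff_dvd)

text \<open>A composite number below \<open>67 ^ 2\<close> has a divisor \<open>d\<close> with
  \<open>1 < d < 67\<close>, and each such \<open>d\<close> is a multiple of a listed prime. Trial
  division then accepts \<open>m\<close> only if \<open>m\<close> is itself listed.\<close>

lemma trial_iff_prime:
  assumes "2 \<le> m" "m < 67\<^sup>2"
  shows "trial (int m) \<longleftrightarrow> prime m"
proof
  assume "prime m"
  then show "trial (int m)"
    unfolding trial_def by (intro trial_by_prime) auto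
next
  let ?ds = "[2,3,5,7,11,13,17,19,23,29,31,37,41,43,47,53,59,61] :: int list"
  assume trial: "trial (int m)"
  show "prime m"
  proof (rule ccontr)
    assume "\<not> prime m"
    then obtain a where "a dvd m" "a \<noteq> 1" "a \<noteq> m"
      using assms by (auto simp: prime_nat_iff)
    then obtain b where m: "m = a * b" by blast
    have ab: "a > 1" "b > 1"
    proof -
      have "a \<noteq> 0" by (rule notI) (use m assms(1) in simp)
      moreover have "b \<noteq> 0" by (rule notI) (use m assms(1) in simp)
      moreover have "b \<noteq> 1" by (rule notI) (use m \<open>a \<noteq> m\<close> in simp)
      ultimately show "a > 1" "b > 1" using \<open>a \<noteq> 1\<close> by linarith+
    qed
    define d where "d = min a b"
    have d: "1 < d" "d dvd m" "d * d \<le> m"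
      using ab unfolding d_def m min_def by (simp_all add: mult_le_mono)
    have "d < 67"
    proof (rule ccontr)
      assume "\<not> d < 67"
      then have "67 * 67 \<le> d * d" by (intro mult_le_mono) auto
      with d assms show False by (simp add: power2_eq_square)
    qed
    have small: "\<forall>d\<in>set [2..<67::nat]. \<exists>q\<in>set ?ds. int d mod q = 0"
      by code_simp
    have "d \<in> set [2..<67]"
      unfolding set_upt atLeastLessThan_iff using d(1) \<open>d < 67\<close> by auto
    from bspec[OF small this] obtain q where q: "q \<in> set ?ds" "int d mod q = 0" ..
    from q(2) have "q dvd int d" by (rule dvd_eq_mod_eq_0 [THEN iffD2])
    then have "q dvd int m" using d(2) by (meson dvd_trans of_nat_dvd_iff)
    then have "int m \<in> set ?ds"
      by (rule trial_by_dvd[OF trial[unfolded trial_def] q(1)])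
    then have "m \<in> {2,3,5,7,11,13,17,19,23,29,31,37,41,43,47,53,59,61}" by auto
    then have "prime m" by auto
    with \<open>\<not> prime m\<close> show False by blast
  qed
qed

lemma bump_correct:
  assumes "0 \<le> b" "c = 2 ^ nat b"
  shows "case bump m c b of (c', b') \<Rightarrow> 0 \<le> b' \<and> c' = 2 ^ nat b' \<and> m \<le> c'"
  using assms
proof (induction m c b rule: bump.induct)
  case (1 m c b)
  show ?case
  proof (cases "m \<le> c \<or> c \<le> 0")
    case True
    then have "bump m c b = (c, b)" by (subst bump.simps) simp
    with True 1 show ?thesis by auto
  next
    case False
    have "bump m c b = bump m (2 * c) (b + 1)" using False by (subst bump.simps) simp
    moreover have "2 * c = 2 ^ nat (b + 1)" using 1 by (simp add: nat_add_distrib)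
    ultimately show ?thesis using 1 False by simp
  qed
qed

lemma primes_le_Suc: "primes_le (Suc n) = (if prime (Suc n) then insert (Suc n) (primes_le n) else primes_le n)"
  by (auto simp: le_Suc_eq)

lemma state_inv_step:
  assumes inv: "state_inv n s" and n: "1 \<le> n" "Suc n < 67\<^sup>2"
  shows "state_inv (Suc n) (step (int (Suc n)) s)"
proof -
  obtain c b w t e r where s: "s = (c, b, w, t, e, r)" by (cases s) auto
  have inv': "0 \<le> b" "c = 2 ^ nat b" "0 \<le> w" "mertens_prod n \<le> w / 10 ^ 9" "theta n \<le> t * (ln 2 / 8)"
     "(\<Sum>p\<in>primes_le n. ln p / (real p - 1)) \<le> e / 10 ^ 6 * (ln 2 / 8)" "r = int (card (primes_le n))"
    using inv by (auto simp: state_inv_def s)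
  show ?thesis
  proof (cases "prime (Suc n)")
    case False
    then have "\<not> trial (int (Suc n))" using n trial_iff_prime[of "Suc n"] by simp
    then have "step (int (Suc n)) s = s" by (simp add: step_def s)
    with False inv show ?thesis
      by (simp add: state_inv_def s mertens_prod_def theta_def primes_le_Suc)
  next
    case True
    let ?m = "Suc n"
    obtain c' b' where cb: "bump (int ?m ^ 8) c b = (c', b')" by (cases "bump (int ?m ^ 8) c b") auto
    have bump: "0 \<le> b'" "c' = 2 ^ nat b'" "int ?m ^ 8 \<le> c'"
      using bump_correct[OF inv'(1,2), of "int ?m ^ 8"] unfolding cb by simp_all
    have tr: "trial (int ?m)" using n trial_iff_prime[of "Suc n"] True by simp
    have step: "step (int ?m) s = (c', b', w - w div int ?m, t + b',
        e + b' * 1000000 div (int ?m - 1) + 1, r + 1)"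
      using tr unfolding step_def s by (simp only: prod.case if_True cb)
    have "?m ^ 8 \<le> 2 ^ nat b'"
      using bump by (metis of_nat_le_iff of_nat_numeral of_nat_power)
    then have "real ?m ^ 8 \<le> 2 ^ nat b'"
      by (metis of_nat_le_iff of_nat_numeral of_nat_power)
    then have "ln (real ?m ^ 8) \<le> ln (2 ^ nat b')"
      by (subst ln_le_cancel_iff) auto
    then have ln_m: "ln (real ?m) \<le> b' * (ln 2 / 8)"
      using bump(1) by (simp add: ln_realpow)
    have P: "primes_le ?m = insert ?m (primes_le n)" using True by (simp add: primes_le_Suc)
    have "mertens_prod ?m = (1 - 1 / real ?m) * mertens_prod n"
      unfolding mertens_prod_def P by (subst prod.insert) auto
    also have "\<dots> \<le> (1 - 1 / real ?m) * (w / 10 ^ 9)"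
      by (intro mult_left_mono inv') auto
    also have "\<dots> = (w - w / real ?m) / 10 ^ 9" by (simp add: field_simps)
    also have "\<dots> \<le> real_of_int (w - w div int ?m) / 10 ^ 9"
      using real_of_int_div4[of w "int ?m"] by (intro divide_right_mono) auto
    finally have 1: "mertens_prod ?m \<le> real_of_int (w - w div int ?m) / 10 ^ 9" .
    have "theta ?m = ln ?m + theta n"
      unfolding theta_def P by (subst sum.insert) auto
    then have 2: "theta ?m \<le> real_of_int (t + b') * (ln 2 / 8)"
      using ln_m inv'(5) by (simp add: algebra_simps)
    have "(\<Sum>p\<in>primes_le ?m. ln p / (real p - 1)) = ln ?m / n + (\<Sum>p\<in>primes_le n. ln p / (real p - 1))"
      unfolding P by (subst sum.insert) auto
    also have "\<dots> \<le> (b' * (ln 2 / 8)) / n + e / 10 ^ 6 * (ln 2 / 8)"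
      using n by (intro add_mono divide_right_mono ln_m inv') auto
    also have "\<dots> = (b' * 1000000 / n + e) / 10 ^ 6 * (ln 2 / 8)"
      using n by (simp add: field_simps)
    also have "\<dots> \<le> real_of_int (e + b' * 1000000 div (int ?m - 1) + 1) / 10 ^ 6 * (ln 2 / 8)"
    proof (intro mult_right_mono divide_right_mono)
      have "real_of_int (b' * 1000000) / real_of_int (int n) \<le> real_of_int (b' * 1000000 div int n) + 1"
        using floor_divide_of_int_eq[of "b' * 1000000" "int n", where 'a = real] by linarith
      then show "b' * 1000000 / n + e \<le> real_of_int (e + b' * 1000000 div (int ?m - 1) + 1)"
        by simp
    qed auto
    finally have 3: "(\<Sum>p\<in>primes_le ?m. ln p / (real p - 1))
        \<le> real_of_int (e + b' * 1000000 div (int ?m - 1) + 1) / 10 ^ 6 * (ln 2 / 8)" .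
    have 4: "r + 1 = int (card (primes_le ?m))"
      unfolding P using inv'(7) by simp
    have "w div int ?m \<le> w" using inv'(3) zdiv_mono2[of w 1 "int ?m"] by simp
    then show ?thesis
      unfolding step state_inv_def using bump 1 2 3 4 by simp
  qed
qed

lemma state_inv_fold:
  assumes "state_inv n s" "1 \<le> n" "n \<le> m" "m < 67\<^sup>2"
  shows "state_inv m (fold step [int n + 1..int m] s)"
  using assms(3,4)
proof (induction m rule: dec_induct)
  case base
  then show ?case using assms(1) by simp
next
  case (step m)
  have "[int n + 1..int (Suc m)] = [int n + 1..int m] @ [int (Suc m)]"
    using step by (subst upto_rec2) auto
  then show ?case
    using step assms(2) state_inv_step[of m] by simp
qed

lemma state_inv_1: "state_inv 1 (1, 0, 1000000000, 0, 0, 0)"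
proof -
  have "primes_le 1 = {}" by (auto dest!: prime_ge_2_nat)
  then show ?thesis unfolding state_inv_def mertens_prod_def theta_def by (simp only: prod.case) simp
qed

lemma state_inv_foldI:
  assumes "state_inv n s" "fold step [a..b] s = s'" "a = int n + 1" "b = int m"
    "1 \<le> n" "n \<le> m" "m < 67\<^sup>2"
  shows "state_inv m s'"
  using state_inv_fold[OF assms(1,5,6,7)] assms(2-4) by simp

text \<open>The tuples here and below are the values of the fold, evaluated in blocks that end at
  the cutoffs \<open>z\<close> and \<open>V\<close> of the final case distinction.\<close>

lemma state_inv_500: "state_inv 500 (4722366482869645213696, 72, 89609775, 5521, 66509351, 95)"
  by (rule state_inv_foldI[OF state_inv_1, of 2 500], code_simp) simp_all

lemma state_inv_1000: "state_inv 1000 (1208925819614629174706176, 80, 80965335, 11116, 74244796, 168)"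
  by (rule state_inv_foldI[OF state_inv_500, of 501 1000], code_simp) simp_all

lemma state_inv_2000: "state_inv 2000 (309485009821345068724781056, 88, 73671737, 22532, 82186664, 303)"
  by (rule state_inv_foldI[OF state_inv_1000, of 1001 2000], code_simp) simp_all

lemma state_inv_4000: "state_inv 4000 (79228162514264337593543950336, 96, 67590729, 45418, 90131027, 550)"
  by (rule state_inv_foldI[OF state_inv_2000, of 2001 4000], code_simp) simp_all

lemma prime_bounds_500:
  "mertens_prod 500 \<le> 89609775 / 10 ^ 9" "theta 500 \<le> 5521 * (ln 2 / 8)" "card (primes_le 500) = 95"
  using state_inv_500 unfolding state_inv_def by simp_all

lemma prime_bounds_1000:
  "mertens_prod 1000 \<le> 80965335 / 10 ^ 9" "theta 1000 \<le> 11116 * (ln 2 / 8)" "card (primes_le 1000) = 168"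
  using state_inv_1000 unfolding state_inv_def by simp_all

lemma prime_bounds_2000:
  "mertens_prod 2000 \<le> 73671737 / 10 ^ 9" "theta 2000 \<le> 22532 * (ln 2 / 8)" "card (primes_le 2000) = 303"
  using state_inv_2000 unfolding state_inv_def by simp_all

lemma prime_bounds_4000:
  "mertens_prod 4000 \<le> 67590729 / 10 ^ 9" "theta 4000 \<le> 45418 * (ln 2 / 8)" "card (primes_le 4000) = 550"
  "(\<Sum>p\<in>primes_le 4000. ln p / (real p - 1)) \<le> 90131027 / 10 ^ 6 * (ln 2 / 8)"
  using state_inv_4000 unfolding state_inv_def by simp_all

subsection \<open>The sufficient condition\<close>

lemma ln_2_bounds: "ln 2 \<in> {0.693147..0.693148 :: real}"
  using ln_approx_bounds[of 2 6] by (simp add: eval_nat_numeral)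

lemma ln_3_bounds: "ln 3 \<in> {1.098612..1.098613 :: real}"
proof -
  \<comment> \<open>The series converges much faster at \<open>3 / 2\<close> than at 3;
    \<open>5 / 4\<close> serves in the same way for \<open>ln 5\<close>.\<close>
  have "ln (3 / 2) \<in> {0.405465..0.4054652 :: real}"
    using ln_approx_bounds[of "3 / 2" 5] by (simp add: eval_nat_numeral)
  moreover have "ln (2::real) \<in> {0.69314715..0.6931475}"
    using ln_approx_bounds[of 2 8] by (simp add: eval_nat_numeral)
  ultimately show ?thesis by (simp add: ln_div)
qed

lemma ln_5_bounds: "ln 5 \<in> {1.609437..1.609439 :: real}"
proof -
  have "ln (5 / 4) \<in> {0.2231435..0.2231437 :: real}"
    using ln_approx_bounds[of "5 / 4" 5] by (simp add: eval_nat_numeral)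
  moreover have "ln (2::real) \<in> {0.69314715..0.6931475}"
    using ln_approx_bounds[of 2 8] by (simp add: eval_nat_numeral)
  moreover have "ln (4::real) = 2 * ln 2"
    using ln_realpow[of 2 2] by simp
  ultimately show ?thesis by (simp add: ln_div)
qed

lemma chebyshev_const_ge: "chebyshev_const \<ge> 0.9212"
  using ln_2_bounds ln_3_bounds ln_5_bounds by (simp add: chebyshev_const_def)

lemma ln_smooth:
  "ln (2 ^ a * 3 ^ b * 5 ^ c) = a * ln 2 + b * ln 3 + c * ln (5::real)"
  by (simp add: ln_mult_pos ln_realpow)

text \<open>Concavity of the logarithm. In the numerical applications \<open>c\<close> has only the
  prime factors 2, 3 and 5, so that \<open>ln c\<close> is a combination of the three known
  logarithms.\<close>

lemma ln_le_tangent: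
  fixes x c :: real
  assumes "x > 0" "c > 0"
  shows "ln x \<le> ln c + x / c - 1"
  using ln_le_minus_one[of "x / c"] assms by (simp add: ln_div)

text \<open>Take a maximal admissible \<open>S\<close>: it is not all of \<open>C\<close>, and
  adding any further \<open>q\<close> would overshoot \<open>b\<close>, so the gap is less than
  \<open>f q <= m\<close>.\<close>

lemma subset_sum_close_below:
  fixes f :: "'a \<Rightarrow> real"
  assumes "finite C" "S0 \<subseteq> C" "\<And>q. q \<in> C \<Longrightarrow> f q \<le> m" "sum f S0 \<le> b" "b < sum f C"
  obtains S where "S0 \<subseteq> S" "S \<subseteq> C" "sum f S \<le> b" "b - m < sum f S"
proof -
  let ?F = "{S. S0 \<subseteq> S \<and> S \<subseteq> C \<and> sum f S \<le> b}"
  have fin: "finite ?F" using assms(1) by (auto intro: finite_subset[of _ "Pow C"])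
  have "S0 \<in> ?F" using assms by simp
  then have "?F \<noteq> {}" by (rule ex_in_conv [THEN iffD1, OF exI])
  from finite_has_maximal[OF fin this] obtain S
    where "S \<in> ?F" and max: "\<forall>T\<in>?F. S \<subseteq> T \<longrightarrow> S = T" ..
  then have S: "S0 \<subseteq> S" "S \<subseteq> C" "sum f S \<le> b" by simp_all
  have "S \<noteq> C" using S(3) assms(5) by auto
  then obtain q where q: "q \<in> C" "q \<notin> S" using S(2) by blast
  have "finite S" using S(2) assms(1) by (rule finite_subset)
  have "insert q S \<notin> ?F"
  proof
    assume "insert q S \<in> ?F"
    from bspec[OF max this] have "S = insert q S" by (rule mp) (rule subset_insertI)
    with q show False by blast
  qed
  then have "sum f (insert q S) > b" using S q subset_insertI2[OF S(1), of q] by simp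
  then have "b < f q + sum f S" using q \<open>finite S\<close> by simp
  with assms(3)[OF q(1)] have "b - m < sum f S" by linarith
  with S that show thesis by blast
qed

section \<open>Prime divisors, the totient, and counting primes\<close>

abbreviation prime_divisors :: "nat \<Rightarrow> nat set" where
  "prime_divisors k \<equiv> {p. prime p \<and> p dvd k}"

lemma finite_prime_divisors: "k > 0 \<Longrightarrow> finite (prime_divisors k)"
  by (rule finite_subset[OF _ finite_divisors_nat]) auto

lemma sum_ln_prime_divisors_le:
  assumes "k > 0" "A \<subseteq> prime_divisors k"
  shows "(\<Sum>p\<in>A. ln (real p)) \<le> ln k"
proof -
  have fin: "finite A" using assms finite_prime_divisors finite_subset by blast
  have "\<Prod>A dvd k" using assms(2) fin by (intro prod_primes_dvd) auto
  then have "\<Prod>A \<le> k" using assms(1) by (intro dvd_imp_le)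
  then have "real (\<Prod>A) \<le> real k" by (rule of_nat_mono)
  moreover have "real (\<Prod>A) > 0"
    unfolding of_nat_prod using assms(2) by (intro prod_pos) (auto intro: prime_gt_0_nat)
  ultimately have "ln (real (\<Prod>A)) \<le> ln k"
    using assms(1) by (subst ln_le_cancel_iff) auto
  also have "ln (real (\<Prod>A)) = (\<Sum>p\<in>A. ln (real p))"
    unfolding of_nat_prod using assms(2) fin by (intro ln_prod) (auto simp: subset_iff intro: prime_gt_0_nat)
  finally show ?thesis .
qed

lemma card_prime_divisors_le:
  assumes "k > 0" "A \<subseteq> prime_divisors k" "\<And>p. p \<in> A \<Longrightarrow> real x \<le> p" "x > 0"
  shows "card A * ln x \<le> ln k"
proof -
  have "card A * ln x = (\<Sum>p\<in>A. ln (real x))" by simp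
  also have "\<dots> \<le> (\<Sum>p\<in>A. ln (real p))"
  proof (rule sum_mono)
    fix p assume "p \<in> A"
    then have "real x \<le> real p" by (rule assms(3))
    then show "ln (real x) \<le> ln (real p)" using assms(4) by (subst ln_le_cancel_iff) auto
  qed
  also have "\<dots> \<le> ln k" using assms(1,2) by (rule sum_ln_prime_divisors_le)
  finally show ?thesis .
qed

text \<open>Euler's product for \<open>totient k / k\<close> is split at \<open>z\<close> and
  \<open>V\<close>. Its primes up to \<open>z\<close> complete the given product to the Mertens
  product, those in \<open>(z, V]\<close> give factors at most \<open>1 - 1 / V\<close>, and the
  rest are bounded by 1.\<close>

lemma totient_density_le:
  fixes k z V :: nat
  assumes "k > 0" "z \<le> V" "V \<ge> 1"
  shows "totient k / k * (\<Prod>q | prime q \<and> q \<le> z \<and> \<not> q dvd k. 1 - 1 / q)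
    \<le> mertens_prod z * (1 - 1 / V) ^ card {p. prime p \<and> p dvd k \<and> z < p \<and> p \<le> V}"
proof -
  let ?A = "{p. prime p \<and> p dvd k \<and> p \<le> z}" and ?B = "{p. prime p \<and> p dvd k \<and> z < p \<and> p \<le> V}"
  let ?C = "{p. prime p \<and> p dvd k \<and> V < p}" and ?Q = "{q. prime q \<and> q \<le> z \<and> \<not> q dvd k}"
  let ?f = "\<lambda>p::nat. 1 - 1 / real p"
  have fin: "finite ?A" "finite ?B" "finite ?C" "finite ?Q"
    using finite_prime_divisors[OF assms(1)] finite_primes_le[of z]
    by (auto elim: finite_subset[rotated])
  have f: "0 \<le> ?f p" "?f p \<le> 1" if "prime p" for p
    using prime_ge_1_nat[OF that] by (auto simp: field_simps)
  have "prime_factors k = ?A \<union> ?B \<union> ?C"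
    using assms by (auto simp: prime_factors_dvd)
  then have "totient k / k = prod ?f (?A \<union> ?B \<union> ?C)"
    using assms(1) by (simp add: totient_formula2)
  also have "\<dots> = prod ?f ?A * prod ?f ?B * prod ?f ?C"
    using fin assms(2) by (subst prod.union_disjoint; (subst prod.union_disjoint)?) auto
  also have "\<dots> \<le> prod ?f ?A * prod ?f ?B * 1"
    using f by (intro mult_left_mono prod_le_1 mult_nonneg_nonneg prod_nonneg) auto
  finally have "totient k / k * prod ?f ?Q \<le> prod ?f ?A * prod ?f ?B * 1 * prod ?f ?Q"
    using f by (intro mult_right_mono prod_nonneg) auto
  also have "\<dots> = prod ?f (?A \<union> ?Q) * prod ?f ?B"
    using fin by (subst prod.union_disjoint) auto
  also have "?A \<union> ?Q = primes_le z" by auto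
  also have "prod ?f (primes_le z) * prod ?f ?B \<le> prod ?f (primes_le z) * (\<Prod>p\<in>?B. 1 - 1 / V)"
    using f assms by (intro mult_left_mono prod_mono prod_nonneg) (auto intro!: divide_left_mono simp: prime_gt_0_nat)
  finally show ?thesis by (simp add: mertens_prod_def)
qed

text \<open>At \<open>X >= 5 / 2 * L\<close> this yields \<open>theta X >= 2 * L\<close>, a
  sufficient supply of primes even after those dividing \<open>k\<close> are discarded.\<close>

lemma theta_ge_linear:
  assumes "n \<ge> 10000"
  shows "theta n \<ge> 0.8 * n"
proof -
  \<comment> \<open>In terms of \<open>s = sqrt n\<close>, the tangent to the logarithm at 100 turns
    the error \<open>(5 + s) * ln n\<close> into a quadratic polynomial in \<open>s\<close>.\<close>
  define s where "s = sqrt n"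
  have s: "s \<ge> 100" unfolding s_def using assms by (intro real_le_rsqrt) simp
  have n: "real n = s\<^sup>2" unfolding s_def by simp
  have "ln (100::real) = 2 * ln 2 + 0 * ln 3 + 2 * ln 5" using ln_smooth[of 2 0 2] by simp
  then have "ln (100::real) \<le> 4.606" using ln_2_bounds ln_5_bounds by simp
  then have "ln s \<le> 3.606 + s / 100"
    using ln_le_tangent[of s 100] s by simp
  then have ln_n: "ln n \<le> 7.212 + s / 50"
    unfolding n using s by (simp add: ln_realpow)
  have "(5 + sqrt n) * ln n \<le> (5 + s) * (7.212 + s / 50)"
    unfolding s_def[symmetric] using s ln_n by (intro mult_left_mono) auto
  moreover have "chebyshev_const * n \<ge> 0.9212 * n"
    using chebyshev_const_ge by (intro mult_right_mono) auto
  moreover have "s * s \<ge> 100 * s" using s by (intro mult_right_mono) auto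
  moreover have "(5 + s) * (7.212 + s / 50) = s * s / 50 + 7.312 * s + 36.06"
    by (simp add: field_simps)
  ultimately have "theta n \<ge> 0.9212 * n - (s * s / 50 + 7.312 * s + 36.06) - 3"
    using chebyshev_theta_ge[of n] assms by linarith
  then have "theta n \<ge> 2253 / 2500 * (s * s) - 914 / 125 * s - 1953 / 50"
    unfolding n power2_eq_square by simp
  then have "theta n \<ge> 8 / 10 * (s * s)"
    using \<open>s * s \<ge> 100 * s\<close> s by linarith
  then show ?thesis unfolding n power2_eq_square by simp
qed

text \<open>Chebyshev's bound at \<open>J * k\<close>, where \<open>ln (J * k)\<close> is at most
  \<open>M\<close>. The summand \<open>k\<close> in the hypothesis on \<open>J\<close> pays for the
  prime divisors of \<open>k\<close> and for the error terms, which are only quadratic in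
  \<open>ln k\<close>.\<close>

lemma card_primes_le_gt:
  fixes k J :: nat
  assumes L: "4156 \<le> ln k"
    and J: "totient k * (ln k + ln (2 * ln k)) / 0.9212 + k \<le> J * k" "J \<le> 2 * ln k"
  shows "card (primes_le (J * k)) > totient k + card (prime_divisors k)"
proof -
  define l where "l = ln (real k)"
  have l: "l \<ge> 4156" using L by (simp add: l_def)
  have k: "k > 0" using L by (cases "k = 0") auto
  have "ln (2 * l) \<le> l"
    using ln_le_tangent[of "2 * l" 2] ln_2_bounds l by simp
  have Lam: "ln (2 * l) \<ge> 0" using l by simp
  define M where "M = l + ln (2 * l)"
  have M: "0 < M" "M \<le> 2 * l" using \<open>ln (2 * l) \<le> l\<close> Lam l unfolding M_def by linarith+
  \<comment> \<open>Squaring this gives \<open>k >= l ^ 4 / 64\<close>, enough growth to absorb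
    every error term.\<close>
  have "exp (l / 2) \<ge> (l / 2)\<^sup>2 / 2"
    using exp_lower_Taylor_quadratic[of "l / 2"] l by simp
  then have "exp (l / 2) * exp (l / 2) \<ge> (l / 2)\<^sup>2 / 2 * ((l / 2)\<^sup>2 / 2)"
    by (intro mult_mono) auto
  moreover have "exp (l / 2) * exp (l / 2) = k"
    using k by (simp add: exp_add[symmetric] l_def)
  ultimately have "k \<ge> l\<^sup>2 * l\<^sup>2 / 64"
    by (simp add: power2_eq_square)
  moreover have "l\<^sup>2 \<ge> 4156\<^sup>2" using l by (intro power_mono) auto
  then have "l\<^sup>2 * l\<^sup>2 \<ge> 4156\<^sup>2 * l\<^sup>2" by (intro mult_right_mono) auto
  ultimately have k_ge: "k \<ge> 1000 * l\<^sup>2" using l by simp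
  have ll: "l\<^sup>2 \<ge> 4156 * l" using l by (simp add: power2_eq_square)
  have "1 * k \<le> J * k"
  proof -
    have "0 \<le> totient k * (ln k + ln (2 * ln k)) / 0.9212"
      using M unfolding M_def l_def by (intro divide_nonneg_nonneg mult_nonneg_nonneg) auto
    with J(1) have "real k \<le> real (J * k)" by linarith
    then show ?thesis by (simp only: of_nat_le_iff mult_1)
  qed
  moreover have "real k \<ge> 30" using k_ge ll l by linarith
  then have "k \<ge> 30" by simp
  ultimately have N: "J * k \<ge> 30" by linarith
  then have "J > 0" by (intro Nat.gr0I) auto
  have "ln (real (J * k)) = ln J + l" using \<open>J > 0\<close> k by (simp add: ln_mult_pos l_def)
  also have "ln (real J) \<le> ln (2 * l)" using J(2) \<open>J > 0\<close> l by (subst ln_le_cancel_iff) (auto simp: l_def)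
  finally have lnN: "ln (real (J * k)) \<le> M" by (simp add: M_def)
  have "real (card (prime_divisors k)) * ln 2 \<le> l"
    using card_prime_divisors_le[OF k order_refl, of 2] prime_ge_2_nat by (fastforce simp: l_def)
  moreover have "real (card (prime_divisors k)) * 0.5 \<le> real (card (prime_divisors k)) * ln 2"
    using ln_2_bounds by (intro mult_left_mono) auto
  ultimately have om: "card (prime_divisors k) \<le> 2 * l" by simp
  have "(card (prime_divisors k) + 5) * M \<le> (2 * l + 5) * (2 * l)"
    using om M l by (intro mult_mono) auto
  also have "\<dots> = 4 * l\<^sup>2 + 10 * l" by (simp add: algebra_simps power2_eq_square)
  finally have small: "(card (prime_divisors k) + 5) * M + 3 < 0.9212 * k"
    using k_ge ll l by simp
  have "totient k * M + 0.9212 * k = 0.9212 * (totient k * M / 0.9212 + k)"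
    by (simp add: field_simps)
  also have "\<dots> \<le> 0.9212 * real (J * k)"
    using J(1) by (intro mult_left_mono) (auto simp: M_def l_def)
  also have "\<dots> \<le> chebyshev_const * real (J * k)"
    using chebyshev_const_ge by (intro mult_right_mono) auto
  also have "\<dots> \<le> card (primes_le (J * k)) * ln (real (J * k)) + 5 * ln (real (J * k)) + 3"
    using chebyshev_card_primes_ge[OF N] by simp
  also have "\<dots> \<le> card (primes_le (J * k)) * M + 5 * M + 3"
    using lnN by (intro add_mono mult_left_mono) auto
  finally have "(totient k + card (prime_divisors k)) * M < card (primes_le (J * k)) * M"
    using small by (simp add: algebra_simps)
  then have "real (totient k + card (prime_divisors k)) < real (card (primes_le (J * k)))"
    using M(1) by (simp add: mult_less_cancel_right_pos)
  then show ?thesis by (simp only: of_nat_less_iff)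
qed

text \<open>The representative prime \<open>s\<close> of the class of \<open>a\<close> must exceed
  \<open>J * k\<close>, so every prime up to \<open>J * k\<close> either precedes \<open>s\<close>
  and is coprime to \<open>k\<close>, or divides \<open>k\<close>; that makes too few
  primes.\<close>

lemma not_P_integer_if_prime_free:
  fixes k a J :: nat
  assumes "k > 1" "a < k" "a > 0" "coprime a k" "\<And>j. j < J \<Longrightarrow> \<not> prime (a + j * k)"
    and "card (primes_le (J * k)) > totient k + card (prime_divisors k)"
  shows "\<not> P_integer k"
proof
  assume "P_integer k"
  then obtain s where s: "prime s" "[s = a] (mod k)"
      "card {p. prime p \<and> coprime p k \<and> p < s} < totient k"
    using P_integer_prime_in_class assms(4) by blast
  have "s mod k = a" using s(2) assms(2) by (simp add: cong_def)
  then have eq: "s = a + (s div k) * k" by (metis add.commute div_mult_mod_eq)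
  with s(1) assms(5)[of "s div k"] have "J \<le> s div k" by fastforce
  then have "J * k \<le> s div k * k" by (rule mult_le_mono1)
  with eq assms(3) have "J * k < s" by linarith
  then have "primes_le (J * k) \<subseteq> {p. prime p \<and> coprime p k \<and> p < s} \<union> prime_divisors k"
    using prime_imp_coprime_nat by auto
  then have "card (primes_le (J * k)) \<le> card ({p. prime p \<and> coprime p k \<and> p < s} \<union> prime_divisors k)"
    using assms(1) finite_prime_divisors[of k] by (intro card_mono) auto
  also have "\<dots> \<le> card {p. prime p \<and> coprime p k \<and> p < s} + card (prime_divisors k)"
    by (rule card_Un_le)
  finally show False using s(3) assms(6) by linarith
qed

text \<open>Measured against \<open>U\<close>, primes up to \<open>X\<close> cost at most 0.92. At
  most \<open>L / 9.2\<close> of the primes lie beyond \<open>X\<close>, costing at most 0.045, and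
  the summands 1 number at most \<open>L / 0.69\<close>, costing about 0.0145.\<close>

lemma sieve_sum_less:
  fixes k z U X :: nat and L :: real
  assumes L: "L = ln k" "4156 \<le> L" and U: "100 * L \<le> U" and X: "5 / 2 * L \<le> X"
    and recip: "(\<Sum>p | prime p \<and> z < p \<and> p \<le> X. 1 / real p) \<le> 0.92"
  shows "(\<Sum>p | prime p \<and> p dvd k \<and> z < p. real U / p + 1) < U"
proof -
  let ?K = "{p. prime p \<and> p dvd k \<and> z < p}"
  let ?A = "{p. prime p \<and> p dvd k \<and> z < p \<and> p \<le> X}" and ?B = "{p. prime p \<and> p dvd k \<and> z < p \<and> X < p}"
  let ?C = "{p. prime p \<and> z < p \<and> p \<le> X}"
  have k: "k > 0" using L by (cases "k = 0") auto
  have fin: "finite ?K" "finite ?A" "finite ?B"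
    using finite_prime_divisors[OF k] by (auto elim: finite_subset[rotated])
  have finC: "finite ?C" by (rule finite_subset[of _ "{..X}"]) auto
  have X0: "real X > 0" using X L by linarith
  have "ln (10000::real) = 4 * ln 2 + 0 * ln 3 + 4 * ln 5" using ln_smooth[of 4 0 4] by simp
  then have "ln (10000::real) \<ge> 9.2" using ln_2_bounds ln_5_bounds by simp
  moreover have "ln (10000::real) \<le> ln X" using X L by (subst ln_le_cancel_iff) auto
  ultimately have lnX: "ln X \<ge> 9.2" by simp
  have "card ?B * ln X \<le> L"
    unfolding L by (rule card_prime_divisors_le) (use k X0 in auto)
  moreover have "card ?B * 9.2 \<le> card ?B * ln X"
    using lnX by (intro mult_left_mono) auto
  ultimately have B: "card ?B * 9.2 \<le> L" by linarith
  have "card ?K * ln (real 2) \<le> L"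
    unfolding L by (rule card_prime_divisors_le) (use k prime_ge_2_nat in auto)
  moreover have "card ?K * 0.69 \<le> card ?K * ln (real 2)"
    using ln_2_bounds by (intro mult_left_mono) auto
  ultimately have K: "card ?K * 0.69 \<le> L" by linarith
  have "(\<Sum>p\<in>?B. real U / p) \<le> (\<Sum>p\<in>?B. real U / X)"
    using X0 by (intro sum_mono divide_left_mono) auto
  also have "\<dots> = U * (card ?B / X)" by simp
  also have "\<dots> \<le> U * 0.045"
  proof (intro mult_left_mono)
    show "card ?B / X \<le> 0.045" using B X X0 by (simp add: divide_le_eq)
  qed auto
  finally have sumB: "(\<Sum>p\<in>?B. real U / p) \<le> U * 0.045" .
  have "(\<Sum>p\<in>?A. real U / p) \<le> (\<Sum>p\<in>?C. real U / p)"
    using finC by (intro sum_mono2) auto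
  also have "\<dots> = U * (\<Sum>p\<in>?C. 1 / real p)" by (simp add: sum_distrib_left)
  also have "\<dots> \<le> U * 0.92" using recip by (intro mult_left_mono) auto
  finally have sumA: "(\<Sum>p\<in>?A. real U / p) \<le> U * 0.92" .
  have "(\<Sum>p\<in>?K. real U / p + 1) = (\<Sum>p\<in>?K. real U / p) + card ?K"
    by (simp add: sum.distrib)
  also have "?K = ?A \<union> ?B" by auto
  also have "(\<Sum>p\<in>?A \<union> ?B. real U / p) = (\<Sum>p\<in>?A. real U / p) + (\<Sum>p\<in>?B. real U / p)"
    using fin by (intro sum.union_disjoint) auto
  also have "?A \<union> ?B = ?K" by auto
  finally show ?thesis using sumA sumB K U L(2) by simp
qed

text \<open>Primes up to \<open>z\<close> sieve greedily; available primes in \<open>(z, V]\<close>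
  are all put into \<open>S\<close>, being cheap, and \<open>S\<close> is filled up with primes up
  to \<open>X\<close>. If no prime in \<open>(z, V]\<close> divides \<open>k\<close>, then
  \<open>S\<close> has at least \<open>Y + 2\<close> elements. The first part of \<open>main\<close>
  handles that case, and the second shows that such prime divisors do no harm.\<close>

lemma not_P_integer_if_bounds:
  fixes k z V X r :: nat and L w t Y :: real
  assumes L: "L = ln k" "4156 \<le> L" and z: "500 \<le> z" "z \<le> V" "V \<le> X" and X: "5 / 2 * L \<le> X"
    and w: "mertens_prod z \<le> w" and t: "theta z \<le> t" and V: "theta V + ln (101 * L) \<le> L"
    and recip: "(\<Sum>p | prime p \<and> z < p \<and> p \<le> X. 1 / real p) \<le> 0.92"
    and r: "r = card {p. prime p \<and> z < p \<and> p \<le> V}"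
    and Y: "Y = (L - t - ln (101 * L) - ln X + r * ln (X / V)) / ln X - 2"
    and main: "w * (L + ln (2 * L)) / 0.9212 \<le> Y" "(V + r) * (ln (X / V) / ln X) \<le> Y"
  shows "\<not> P_integer k"
proof -
  have k: "k > 1" using L by (cases "k = 0 \<or> k = 1") auto
  have X0: "real X \<ge> 10000" using X L by linarith
  have lnX: "ln X > 0" using X0 by simp
  define e where "e = ln (real X / V) / ln X"
  have lnXV: "ln (real X / V) \<ge> 0" using z X0 by (intro ln_ge_zero) auto
  then have e0: "e \<ge> 0" unfolding e_def using lnX by (intro divide_nonneg_nonneg) auto
  define U where "U = nat \<lceil>100 * L\<rceil>"
  have U: "100 * L \<le> U" "U \<le> 100 * L + 1" using L(2) by (auto simp: U_def)
  let ?D = "{p. prime p \<and> p dvd k \<and> z < p \<and> p \<le> X}"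
  let ?H = "{p. prime p \<and> p dvd k \<and> z < p \<and> p \<le> V}"
  define C where "C = {q. prime q \<and> \<not> q dvd k \<and> z < q \<and> q \<le> X}"
  define S0 where "S0 = {q. prime q \<and> \<not> q dvd k \<and> z < q \<and> q \<le> V}"
  define h where "h = card ?H"
  have fin: "finite C" "finite S0" "finite ?D" "finite ?H"
    unfolding C_def S0_def
    by (rule finite_subset[of _ "{..X}"] finite_subset[of _ "{..V}"]; auto)+
  have ln_nonneg: "ln (real p) \<ge> 0" if "prime p" for p
    using prime_ge_1_nat[OF that] by simp
  have "card (S0 \<union> ?H) = card S0 + h"
    unfolding h_def using fin by (intro card_Un_disjoint) (auto simp: S0_def)
  moreover have "S0 \<union> ?H = {p. prime p \<and> z < p \<and> p \<le> V}" by (auto simp: S0_def)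
  ultimately have rh: "r = card S0 + h" unfolding r by simp
  \<comment> \<open>The budget for the sum of \<open>ln q\<close> over \<open>S\<close>: what
    remains of \<open>ln k\<close> after the factor \<open>U + 1\<close> and the primes up to
    \<open>z\<close>.\<close>
  define b where "b = L - ln (real U + 1) - theta z"
  have lnU: "0 < ln (real U + 1)" "ln (real U + 1) \<le> ln (101 * L)"
    using U L(2) by auto
  have "primes_le V = primes_le z \<union> {p. prime p \<and> z < p \<and> p \<le> V}" using z by auto
  then have "theta V = theta z + (\<Sum>p | prime p \<and> z < p \<and> p \<le> V. ln (real p))"
    unfolding theta_def using finite_subset[of "{p. prime p \<and> z < p \<and> p \<le> V}" "{..V}"]
    by (subst sum.union_disjoint[symmetric]) auto
  moreover have "(\<Sum>q\<in>S0. ln (real q)) \<le> (\<Sum>p | prime p \<and> z < p \<and> p \<le> V. ln (real p))"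
    using finite_subset[of "{p. prime p \<and> z < p \<and> p \<le> V}" "{..V}"] ln_nonneg
    by (intro sum_mono2) (auto simp: S0_def)
  ultimately have S0_le: "(\<Sum>q\<in>S0. ln (real q)) \<le> b"
    unfolding b_def using V lnU by linarith
  have "primes_le X = primes_le z \<union> (C \<union> ?D)" using z by (auto simp: C_def)
  then have "theta X = (\<Sum>p\<in>primes_le z \<union> (C \<union> ?D). ln (real p))"
    unfolding theta_def by simp
  also have "\<dots> = theta z + ((\<Sum>p\<in>C. ln (real p)) + (\<Sum>p\<in>?D. ln (real p)))"
    unfolding theta_def using fin
    by (subst sum.union_disjoint; (subst sum.union_disjoint)?) (auto simp: C_def)
  finally have "theta X = theta z + ((\<Sum>p\<in>C. ln (real p)) + (\<Sum>p\<in>?D. ln (real p)))" .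
  moreover have "(\<Sum>p\<in>?D. ln (real p)) \<le> L"
    unfolding L using k by (intro sum_ln_prime_divisors_le) auto
  \<comment> \<open>The primes up to \<open>X\<close> have logarithms adding up to at least
    \<open>0.8 * (5 / 2) * L\<close>, of which those dividing \<open>k\<close> take at most
    \<open>L\<close>.\<close>
  moreover have "theta X \<ge> 2 * L"
    using theta_ge_linear[of X] X X0 by simp
  ultimately have C_gt: "b < (\<Sum>q\<in>C. ln (real q))"
    unfolding b_def using lnU by linarith
  have "S0 \<subseteq> C" using z by (auto simp: S0_def C_def)
  moreover have "ln (real q) \<le> ln X" if "q \<in> C" for q
    using that X0 by (subst ln_le_cancel_iff) (auto simp: C_def prime_gt_0_nat)
  ultimately obtain S where S: "S0 \<subseteq> S" "S \<subseteq> C" "(\<Sum>q\<in>S. ln (real q)) \<le> b"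
      "b - ln X < (\<Sum>q\<in>S. ln (real q))"
    using subset_sum_close_below[of C S0 "\<lambda>q. ln (real q)" "ln X" b] fin S0_le C_gt by blast
  have finS: "finite S" using S(2) fin(1) by (rule finite_subset)
  have prime_S: "prime q \<and> z < q \<and> \<not> q dvd k" if "q \<in> S" for q
    using that S(2) by (auto simp: C_def)
  \<comment> \<open>A prime \<open>q \<le> V\<close> uses up only \<open>ln q\<close>, not \<open>ln X\<close>, of the budget \<open>b\<close>. The \<open>h\<close> such primes that
    divide \<open>k\<close> are lost for \<open>S\<close>, but each of them lowers the totient by a factor \<open>1 - 1 / V\<close>.\<close>
  have card_S: "card S \<ge> Y + 2 - h * e"
  proof -
    have "(\<Sum>q\<in>S. ln (real q)) \<le> (\<Sum>q\<in>S. ln X - (if q \<in> S0 then ln (real X / V) else 0))"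
    proof (rule sum_mono)
      fix q assume q: "q \<in> S"
      then have q0: "real q > 0" "real q \<le> X" using S(2) by (auto simp: C_def prime_gt_0_nat)
      show "ln (real q) \<le> ln X - (if q \<in> S0 then ln (real X / V) else 0)"
      proof (cases "q \<in> S0")
        case True
        then have "real q \<le> V" by (simp add: S0_def)
        then have "ln (real q) \<le> ln V" using q0 by (subst ln_le_cancel_iff) auto
        then show ?thesis using True z X0 by (simp add: ln_div)
      next
        case False
        then show ?thesis using q0 by simp
      qed
    qed
    also have "\<dots> = card S * ln X - card S0 * ln (real X / V)"
      using finS S(1) by (simp add: sum_subtractf sum.If_cases Int_absorb1)
    finally have "card S * ln X \<ge> b - ln X + card S0 * ln (real X / V)"
      using S(4) by linarith
    moreover have "b \<ge> L - t - ln (101 * L)" unfolding b_def using lnU t by linarith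
    ultimately have "card S * ln X \<ge> L - t - ln (101 * L) - ln X + (real r - h) * ln (real X / V)"
      by (simp add: rh)
    then have "(L - t - ln (101 * L) - ln X + r * ln (real X / V) - h * ln (real X / V)) / ln X \<le> card S"
      using lnX by (simp add: divide_le_eq algebra_simps)
    then show ?thesis
      unfolding Y e_def by (simp add: diff_divide_distrib)
  qed
  have size: "(U + 1) * (\<Prod>(primes_le z) * \<Prod>S) \<le> k"
  proof -
    have pos: "real (\<Prod>(primes_le z)) > 0" "real (\<Prod>S) > 0"
      unfolding of_nat_prod using prime_S by (auto intro!: prod_pos prime_gt_0_nat)
    have "ln (real (\<Prod>(primes_le z))) = theta z"
      unfolding of_nat_prod theta_def by (intro ln_prod) (auto simp: prime_gt_0_nat)
    moreover have "ln (real (\<Prod>S)) = (\<Sum>q\<in>S. ln (real q))"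
      unfolding of_nat_prod using finS prime_S by (intro ln_prod) (auto simp: prime_gt_0_nat)
    ultimately have "ln (real (U + 1) * (real (\<Prod>(primes_le z)) * real (\<Prod>S))) \<le> ln k"
      using pos S(3) by (simp add: ln_mult_pos b_def L add_ac)
    then have "real (U + 1) * (real (\<Prod>(primes_le z)) * real (\<Prod>S)) \<le> real k"
      using pos k by (subst (asm) ln_le_cancel_iff) auto
    then show ?thesis by (simp only: of_nat_mult [symmetric] of_nat_le_iff)
  qed
  define T where "T = (L + ln (2 * L)) / 0.9212"
  define d where "d = totient k / k"
  have d: "0 \<le> d" "d \<le> 1" unfolding d_def using k totient_le[of k] by (auto simp: divide_le_eq)
  have "ln (2 * L) \<le> L / 50"
  proof -
    have "ln (1000::real) = 3 * ln 2 + 0 * ln 3 + 3 * ln 5" using ln_smooth[of 3 0 3] by simp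
    then have "ln (1000::real) \<le> 7" using ln_2_bounds ln_5_bounds by simp
    then show ?thesis using ln_le_tangent[of "2 * L" 1000] L(2) by simp
  qed
  moreover have "ln (2 * L) \<ge> 0" using L(2) by simp
  ultimately have T: "0 \<le> T" "T + 2 \<le> 2 * L" unfolding T_def using L(2) by (simp_all add: field_simps)
  \<comment> \<open>The \<open>+ 1\<close> provides the summand \<open>k\<close> in the prime count.
    Rounding up makes \<open>J\<close> at most \<open>d * T + 2\<close>, and since
    \<open>?P <= 1\<close> this excess is covered by the \<open>- 2\<close> in
    \<open>Y\<close>.\<close>
  define J where "J = nat \<lceil>d * T\<rceil> + 1"
  have dT: "0 \<le> d * T" "d * T \<le> T" using d T mult_right_mono[of d 1 T] by auto
  have J: "d * T + 1 \<le> J" "J \<le> d * T + 2" using dT by (auto simp: J_def) linarith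
  let ?P = "\<Prod>q | prime q \<and> q \<le> z \<and> \<not> q dvd k. 1 - 1 / real q"
  have P: "0 \<le> ?P" "?P \<le> 1"
    by (auto intro!: prod_nonneg prod_le_1 simp: prime_gt_0_nat divide_le_eq Suc_le_eq)
  have w0: "0 \<le> w"
  proof -
    have "0 \<le> mertens_prod z"
      unfolding mertens_prod_def by (intro prod_nonneg) (auto simp: divide_le_eq Suc_le_eq prime_gt_0_nat)
    with w show ?thesis by linarith
  qed
  have cover: "J * ?P \<le> card S"
  proof -
    have V0: "real V \<ge> 500" using z by simp
    \<comment> \<open>Bernoulli's inequality for \<open>(1 + 1 / V) ^ h\<close>, combined with
      \<open>(1 - 1 / V) * (1 + 1 / V) <= 1\<close>.\<close>
    have "(1 - 1 / real V) ^ h \<le> 1 / (1 + h / V)"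
    proof -
      have "(- 1 :: real) \<le> 0" "0 \<le> 1 / real V" by simp_all
      then have "1 + h * (1 / real V) \<le> (1 + 1 / real V) ^ h"
        by (intro Bernoulli_inequality) linarith
      then have "(1 - 1 / real V) ^ h * (1 + h / V) \<le> (1 - 1 / real V) ^ h * (1 + 1 / V) ^ h"
        using V0 by (intro mult_left_mono) auto
      also have "\<dots> = (1 - (1 / real V)\<^sup>2) ^ h"
        by (simp add: power_mult_distrib[symmetric] algebra_simps power2_eq_square)
      also have "\<dots> \<le> 1" using V0 by (intro power_le_one) (auto simp: power_le_one divide_le_eq)
      finally show ?thesis using V0 by (simp add: le_divide_eq add_pos_nonneg)
    qed
    then have "d * ?P \<le> w * (1 / (1 + h / V))"
      using totient_density_le[of k z V] k z w w0 mult_mono[of "mertens_prod z" w "(1 - 1 / real V) ^ h" "1 / (1 + h / V)"] V0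
      unfolding d_def h_def by (auto intro: order_trans)
    then have "d * ?P * T \<le> w * (1 / (1 + h / V)) * T"
      using T by (intro mult_right_mono) auto
    also have "\<dots> = w * T / (1 + h / V)" by simp
    also have "\<dots> \<le> Y / (1 + h / V)"
      using main(1) V0 unfolding T_def by (intro divide_right_mono) (auto simp: mult.assoc)
    \<comment> \<open>This reduces to \<open>h / V * (Y - (V + h) * e) >= 0\<close>: the gain in the
      totient outweighs the loss \<open>h * e\<close> in \<open>S\<close>. The second part of
      \<open>main\<close> supplies it, because \<open>h <= r\<close>.\<close>
    also have "\<dots> \<le> Y - h * e"
    proof -
      have "h \<le> r" using rh by simp
      then have "(V + h) * e \<le> (V + r) * e" using e0 by (intro mult_right_mono) auto
      also have "\<dots> \<le> Y" using main(2) by (simp add: e_def)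
      finally have "0 \<le> h / real V * (Y - (V + h) * e)" using V0 by (intro mult_nonneg_nonneg) auto
      moreover have "(Y - h * e) * (1 + h / V) = Y + h / real V * (Y - (V + h) * e)"
        using V0 by (simp add: field_simps)
      ultimately have "Y \<le> (Y - h * e) * (1 + h / V)"
        by linarith
      then show ?thesis using V0 by (simp add: divide_le_eq add_pos_nonneg)
    qed
    finally have "d * ?P * T \<le> Y - h * e" .
    moreover have "J * ?P \<le> (d * T + 2) * ?P" using J P by (intro mult_right_mono) auto
    moreover have "(d * T + 2) * ?P = d * ?P * T + 2 * ?P" by (simp add: algebra_simps)
    ultimately show ?thesis using card_S P by linarith
  qed
  obtain a where a: "0 < a" "a < k" "coprime a k" "\<And>j. j < J \<Longrightarrow> \<not> prime (a + j * k)"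
    using prime_free_progression[OF _ _ finS prime_S size cover sieve_sum_less[OF L U(1) X recip]] k z
    by auto
  have "totient k * (ln k + ln (2 * ln k)) / 0.9212 + k \<le> J * k"
  proof -
    have "(d * T + 1) * k \<le> J * k" unfolding of_nat_mult using J(1) by (intro mult_right_mono) auto
    moreover have "(d * T + 1) * k = totient k * T + k" using k by (simp add: d_def field_simps)
    moreover have "totient k * T = totient k * (ln k + ln (2 * ln k)) / 0.9212"
      by (simp only: T_def L times_divide_eq_right)
    ultimately show ?thesis by linarith
  qed
  moreover have "J \<le> 2 * ln k" using J dT T L by simp
  ultimately have "card (primes_le (J * k)) > totient k + card (prime_divisors k)"
    using card_primes_le_gt[of k J] L by simp
  with not_P_integer_if_prime_free[of k a J] k a show ?thesis by blast
qed

subsection \<open>Verification of the condition\<close>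

text \<open>For \<open>p > z\<close>, the term \<open>1 / p\<close> is at most
  \<open>(ln p / p) / ln z\<close>.\<close>

lemma sum_recip_prime_between:
  fixes z X :: nat
  assumes "2 \<le> z" "z \<le> X"
  shows "(\<Sum>p | prime p \<and> z < p \<and> p \<le> X. 1 / real p)
    \<le> (ln X - ln z + ln 4 + (ln X + 1 + 3 * card (primes_le z) * ln X) / X) / ln z"
proof -
  have lz: "ln (real z) > 0" using assms by simp
  have "(\<Sum>p | prime p \<and> z < p \<and> p \<le> X. 1 / real p) * ln z
      \<le> (\<Sum>p | prime p \<and> z < p \<and> p \<le> X. ln p / p)"
    unfolding sum_distrib_right
  proof (rule sum_mono)
    fix p assume "p \<in> {p. prime p \<and> z < p \<and> p \<le> X}"
    then have "ln (real z) \<le> ln (real p)" using assms by (subst ln_le_cancel_iff) auto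
    then show "1 / real p * ln z \<le> ln p / p" by (simp add: divide_right_mono)
  qed
  also have "\<dots> \<le> ln X - ln z + ln 4 + (ln X + 1 + 3 * card (primes_le z) * ln X) / X"
    using sum_ln_over_prime_between[OF assms] by simp
  finally show ?thesis using lz by (simp add: le_divide_eq)
qed

lemma ln_4_le: "ln 4 \<le> (1.3863 :: real)"
proof -
  have "ln (4::real) = 2 * ln 2" using ln_realpow[of 2 2] by simp
  then show ?thesis using ln_2_bounds by simp
qed

text \<open>Reduces the conditions for all \<open>L\<close> in \<open>[a, b]\<close> to inequalities
  between constants and the condition \<open>main\<close>, which is linear in \<open>L\<close>. Here
  \<open>lX\<close> dominates \<open>ln X\<close> throughout, and \<open>ymin\<close> bounds
  \<open>Y\<close> from below, its worst case being \<open>L = a\<close>.\<close>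

lemma not_P_integer_on_interval:
  fixes k z V r :: nat and L a b lX lz w t c ymin :: real
  assumes L: "L = ln k" "a \<le> L" "L \<le> b" and a: "4156 \<le> a" "V \<le> 5 / 2 * a"
    and z: "500 \<le> z" "z \<le> V"
    and lX: "ln (5 / 2 * b + 1) \<le> lX" and lz: "lz \<le> ln z" "1 \<le> lz" and lV: "lV \<le> ln V" "ln V \<le> lV + 0.01"
    and w: "mertens_prod z \<le> w" and t: "theta z \<le> t" and V: "theta V + lX + 3.71 \<le> a"
    and c: "card (primes_le z) \<le> c"
    and r: "r = card {p. prime p \<and> z < p \<and> p \<le> V}"
    and recip: "lX - lz + 1.3863 + (lX + 1 + 3 * c * lX) / (5 / 2 * a) \<le> 0.92 * lz"
    and main: "\<And>L. a \<le> L \<Longrightarrow> L \<le> b \<Longrightarrow>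
      lX * (w * (L + lX) + (3 - real r) * 0.9212) \<le> (L - t - (lX + 3.71) - r * (lV + 0.01)) * 0.9212"
    and r_le: "r \<le> w * a / 0.9212 + 3" "r \<le> ymin + 3"
    and ymin: "lX * (ymin + 3 - r) \<le> a - t - (lX + 3.71) - r * (lV + 0.01)"
      "(V + r) * (lX - lV) \<le> ymin * lX"
  shows "\<not> P_integer k"
proof -
  define X where "X = nat \<lceil>5 / 2 * L\<rceil>"
  define x where "x = ln (real X)"
  have X: "5 / 2 * L \<le> X" "X \<le> 5 / 2 * L + 1" using L a by (auto simp: X_def)
  have X0: "real X \<ge> 10000" using X L a by linarith
  have VX: "V \<le> X" using a X L by linarith
  have x: "0 < x" "x \<le> lX"
  proof -
    show "0 < x" using X0 by (simp add: x_def)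
    have "x \<le> ln (5 / 2 * b + 1)" unfolding x_def using X X0 L by (subst ln_le_cancel_iff) auto
    with lX show "x \<le> lX" by simp
  qed
  have w0: "0 \<le> w"
  proof -
    have "0 \<le> mertens_prod z"
      unfolding mertens_prod_def by (intro prod_nonneg) (auto simp: divide_le_eq Suc_le_eq prime_gt_0_nat)
    with w show ?thesis by linarith
  qed
  \<comment> \<open>From \<open>L <= X / (5 / 2)\<close> comes \<open>101 * L <= 40.4 * X\<close>;
    the factor is rounded up to \<open>81 / 2\<close>, whose logarithm involves only
    \<open>ln 2\<close> and \<open>ln 3\<close>. This is the source of 3.71.\<close>
  have "ln (81 / 2 :: real) \<le> 3.705"
    using ln_smooth[of 0 4 0] ln_2_bounds ln_3_bounds by (simp add: ln_div)
  moreover have "ln (101 * L) \<le> ln (81 / 2 * real X)"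
    using X L a X0 by (subst ln_le_cancel_iff) auto
  moreover have "ln (81 / 2 * real X) = ln (81 / 2) + x"
    unfolding x_def using X0 by (intro ln_mult_pos) auto
  ultimately have l101: "ln (101 * L) \<le> lX + 3.705" using x(2) by linarith
  have "ln (2 * L) \<le> x" unfolding x_def using X L a by (subst ln_le_cancel_iff) auto
  with x have l2: "ln (2 * L) \<le> lX" by simp
  define Y where "Y = (L - t - ln (101 * L) - ln X + r * ln (X / V)) / ln X - 2"
  have lXV: "ln (real X / V) = x - ln V" using X0 z by (simp add: ln_div x_def)
  \<comment> \<open>Clearing the denominator, \<open>y <= Y\<close> means
    \<open>x * (y + 3 - r) <= L - t - ln (101 * L) - r * ln V\<close>. The sign condition on
    \<open>y + 3 - r\<close> permits replacing \<open>x\<close> by the larger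
    \<open>lX\<close>.\<close>
  have Y_ge: "y \<le> Y" if y: "0 \<le> y + 3 - r" "lX * (y + 3 - r) \<le> L - t - (lX + 3.71) - r * (lV + 0.01)" for y :: real
  proof -
    have "x * (y + 3 - r) \<le> lX * (y + 3 - r)" using x y by (intro mult_right_mono) auto
    also have "\<dots> \<le> L - t - ln (101 * L) - r * ln V"
    proof -
      have "r * ln V \<le> r * (lV + 0.01)" using lV by (intro mult_left_mono) auto
      with y(2) l101 show ?thesis by simp
    qed
    finally have "(y + 2) * x \<le> L - t - ln (101 * L) - x + r * (x - ln V)"
      by (simp add: algebra_simps)
    then have "y + 2 \<le> (L - t - ln (101 * L) - x + r * (x - ln V)) / x"
      using x(1) by (simp add: le_divide_eq)
    then show ?thesis unfolding Y_def lXV x_def[symmetric] by simp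
  qed
  have main1: "w * (L + ln (2 * L)) / 0.9212 \<le> Y"
  proof -
    have "w * (L + ln (2 * L)) / 0.9212 \<le> w * (L + lX) / 0.9212"
      using w0 l2 by (intro divide_right_mono mult_left_mono) auto
    also have "\<dots> \<le> Y"
    proof (rule Y_ge)
      have "w * a / 0.9212 \<le> w * (L + lX) / 0.9212"
        using w0 L x by (intro divide_right_mono mult_left_mono) auto
      with r_le(1) show "0 \<le> w * (L + lX) / 0.9212 + 3 - r" by linarith
      have "lX * (w * (L + lX) / 0.9212 + 3 - r) = lX * (w * (L + lX) + (3 - real r) * 0.9212) / 0.9212"
        by (simp add: field_simps)
      also have "\<dots> \<le> L - t - (lX + 3.71) - r * (lV + 0.01)"
        using main[OF L(2,3)] by (subst pos_divide_le_eq) auto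
      finally show "lX * (w * (L + lX) / 0.9212 + 3 - r) \<le> L - t - (lX + 3.71) - r * (lV + 0.01)" .
    qed
    finally show ?thesis .
  qed
  have "ymin \<le> Y"
    using r_le(2) ymin(1) L(2) by (intro Y_ge) auto
  have main2: "(V + r) * (ln (X / V) / ln X) \<le> Y"
  proof -
    have "ln (real z) \<le> ln (real V)" using z by (subst ln_le_cancel_iff) auto
    with lz have "1 \<le> ln (real V)" by linarith
    with lV(2) have "lV > 0" by simp
    \<comment> \<open>The ratio \<open>(x - lV) / x\<close> increases with \<open>x\<close>, so its
      value at \<open>lX\<close> is an upper bound.\<close>
    have "(V + r) * (x - ln V) * lX \<le> (V + r) * (lX - lV) * x"
    proof -
      have "(x - ln V) * lX \<le> (x - lV) * lX"
        using lV x by (intro mult_right_mono) auto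
      also have "\<dots> \<le> (lX - lV) * x"
        using mult_left_mono[OF x(2), of lV] \<open>lV > 0\<close> by (simp add: algebra_simps)
      finally show ?thesis using mult_left_mono[of "(x - ln V) * lX" "(lX - lV) * x" "real (V + r)"]
        by (simp add: mult.assoc)
    qed
    also have "\<dots> \<le> ymin * lX * x" using ymin(2) x by (intro mult_right_mono) auto
    finally have "(V + r) * (x - ln V) \<le> ymin * x" using x by (simp add: mult_ac mult_le_cancel_left_pos)
    then have "(V + r) * (ln (X / V) / ln X) \<le> ymin"
      unfolding lXV x_def[symmetric] using x(1) by (simp add: divide_le_eq)
    with \<open>ymin \<le> Y\<close> show ?thesis by linarith
  qed
  have rec: "(\<Sum>p | prime p \<and> z < p \<and> p \<le> X. 1 / real p) \<le> 0.92"
  proof -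
    have c0: "0 \<le> c" using c by (meson of_nat_0_le_iff order_trans)
    have "(ln X + 1 + 3 * card (primes_le z) * ln X) / X \<le> (lX + 1 + 3 * c * lX) / (5 / 2 * a)"
      unfolding x_def[symmetric] using x c c0 X L a
      by (intro frac_le add_mono mult_mono) auto
    then have "ln X - ln z + ln 4 + (ln X + 1 + 3 * card (primes_le z) * ln X) / X \<le> 0.92 * lz"
      using recip x ln_4_le lz unfolding x_def[symmetric] by linarith
    also have "\<dots> \<le> 0.92 * ln z" using lz by simp
    finally have "(ln X - ln z + ln 4 + (ln X + 1 + 3 * card (primes_le z) * ln X) / X) / ln z \<le> 0.92"
      using lz by (simp add: divide_le_eq)
    with sum_recip_prime_between[of z X] z VX show ?thesis by linarith
  qed
  show ?thesis
  proof (rule not_P_integer_if_bounds[OF L(1) _ z VX X(1) w t _ rec r Y_def main1 main2])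
    show "4156 \<le> L" using L a by linarith
    show "theta V + ln (101 * L) \<le> L" using V l101 L(2) by simp
  qed
qed

text \<open>Mertens' limit constant is \<open>exp (- gamma) = 0.561...\<close>; starting the
  explicit estimate at 4000 costs the factor 1.06641 and yields 0.598.\<close>

lemma mertens_prod_le_const:
  assumes "N \<ge> 4000"
  shows "mertens_prod N \<le> 0.598 / ln (real N)"
proof -
  define E where "E = 90131027 / 10 ^ 6 * (ln 2 / 8 :: real)"
  have E: "E \<le> 7.8093" using ln_2_bounds by (simp add: E_def)
  have "ln (4000::real) = 5 * ln 2 + 3 * ln 5" using ln_smooth[of 5 0 3] by simp
  then have l4000: "8.294 \<le> ln (4000::real)" "ln (4000::real) \<le> 8.2941" using ln_2_bounds ln_5_bounds by simp_all
  have l: "8.294 \<le> ln (real 4000 + 1)" "ln (real 4000 + 1) \<le> 8.295"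
  proof -
    have "ln (4000::real) \<le> ln (real 4000 + 1)" by simp
    with l4000 show "8.294 \<le> ln (real 4000 + 1)" by linarith
    show "ln (real 4000 + 1) \<le> 8.295" using ln_le_tangent[of 4001 4000] l4000 by simp
  qed
  define q where "q = (1 + E + 1 / 4000) / ln (real 4000 + 1)"
  have "q \<le> 8.80956 / 8.294"
    unfolding q_def using E l by (intro frac_le) auto
  then have "exp (q - 1 + 1 / 4000) \<le> exp 0.0625" by simp
  also have "\<dots> \<le> 1 + 0.0625 + 0.0625\<^sup>2" by (rule exp_bound) auto
  finally have ex: "exp (q - 1 + 1 / 4000) \<le> 1.06641"
    by (simp add: power2_eq_square)
  have pos: "0 \<le> mertens_prod 4000"
    unfolding mertens_prod_def by (intro prod_nonneg) (auto simp: divide_le_eq Suc_le_eq prime_gt_0_nat)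
  have "mertens_prod N \<le> mertens_prod 4000 * ln (real 4000 + 1)
      * exp (q - 1 + 1 / 4000) / ln (real N + 1)"
    using mertens_prod_le[of 4000 N E] assms prime_bounds_4000(4) by (simp add: E_def q_def add_ac)
  also have "\<dots> \<le> 0.0675908 * 8.295 * 1.06641 / ln (real N + 1)"
    using prime_bounds_4000(1) l ex assms pos by (intro divide_right_mono mult_mono) auto
  also have "\<dots> \<le> 0.598 / ln (real N)"
    using assms by (intro frac_le) auto
  finally show ?thesis .
qed

lemma frac_le_cross:
  fixes a b c d :: real
  assumes "a * d \<le> c * b" "0 < b" "0 < d"
  shows "a / b \<le> c / d"
  using assms by (simp add: frac_le_eq divide_simps)

text \<open>Here \<open>z\<close> grows like \<open>L / 16\<close> and \<open>V = z\<close>, so no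
  primes are forced and \<open>r = 0\<close>. The primes up to \<open>z\<close> cost at most
  \<open>0.08665 * L\<close> of the budget, and \<open>0.598 / 0.9212\<close> is so far below what
  remains that the shifts in the logarithms are absorbed.\<close>

lemma not_P_integer_large:
  fixes k :: nat and L :: real
  assumes L: "L = ln k" "200000 \<le> L"
  shows "\<not> P_integer k"
proof -
  define l where "l = ln L"
  define z where "z = nat \<lfloor>L / 16\<rfloor>"
  define X where "X = nat \<lceil>5 / 2 * L\<rceil>"
  have z: "L / 16 - 1 \<le> z" "z \<le> L / 16"
  proof -
    have "real z = of_int \<lfloor>L / 16\<rfloor>" using L(2) by (simp add: z_def)
    then show "L / 16 - 1 \<le> z" "z \<le> L / 16" by linarith+
  qed
  have X: "5 / 2 * L \<le> X" "X \<le> 5 / 2 * L + 1" using L(2) by (auto simp: X_def)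
  have z4000: "z \<ge> 12000" using z L(2) by linarith
  have zX: "z \<le> X" using z X L(2) by linarith
  have "ln (200000::real) = 6 * ln 2 + 5 * ln 5" using ln_smooth[of 6 0 5] by simp
  then have c: "ln (200000::real) \<ge> 12.2" "ln (200000::real) \<le> 12.21" using ln_2_bounds ln_5_bounds by simp_all
  have "ln (200000::real) \<le> ln L" using L(2) by (subst ln_le_cancel_iff) auto
  with c have l: "12.2 \<le> l" by (simp add: l_def)
  have l_le: "l \<le> L / 10000"
    using ln_le_tangent[of L 200000] c L(2) by (simp add: l_def)
  have lnX: "ln X \<le> l + 0.917"
  proof -
    have "ln (5 / 2 :: real) \<le> 0.9163" using ln_2_bounds ln_5_bounds by (simp add: ln_div)
    moreover have "ln (1.0001 :: real) \<le> 0.0001" using ln_le_tangent[of "1.0001" 1] by simp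
    moreover have "ln (real X) \<le> ln (5 / 2 * 1.0001 * L)"
      using X L(2) by (subst ln_le_cancel_iff) auto
    moreover have "ln (5 / 2 * 1.0001 * L) = ln (5 / 2) + ln 1.0001 + l"
      using L(2) unfolding l_def by (subst ln_mult_pos; (subst ln_mult_pos)?) auto
    ultimately show ?thesis by simp
  qed
  have lnX_ge: "ln X \<ge> l"
    unfolding l_def using X L(2) by (subst ln_le_cancel_iff) auto
  have lnz: "ln z \<ge> l - 2.774"
  proof -
    have "ln (16 :: real) = 4 * ln 2" using ln_realpow[of 2 4] by simp
    then have "ln (16.01 :: real) \<le> 2.774" using ln_2_bounds ln_le_tangent[of "16.01" 16] by simp
    moreover have "ln (L / 16.01) \<le> ln (real z)"
      using z L(2) by (subst ln_le_cancel_iff) (auto simp: field_simps)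
    moreover have "ln (L / 16.01) = l - ln 16.01"
      using L(2) unfolding l_def by (intro ln_divide_pos) auto
    ultimately show ?thesis by simp
  qed
  have l101: "ln (101 * L) \<le> l + 4.7"
  proof -
    have "ln (100 :: real) = 2 * ln 2 + 2 * ln 5" using ln_smooth[of 2 0 2] by simp
    then have "ln (101 :: real) \<le> 4.7" using ln_2_bounds ln_5_bounds ln_le_tangent[of 101 100] by simp
    moreover have "ln (101 * L) = ln 101 + l"
      unfolding l_def using L(2) by (intro ln_mult_pos) auto
    ultimately show ?thesis by simp
  qed
  have "ln (2 * L) = ln 2 + l"
    unfolding l_def using L(2) by (intro ln_mult_pos) auto
  then have l2: "ln (2 * L) \<le> l + 0.7"
    using ln_2_bounds by simp
  define t where "t = 0.08665 * L"
  have t: "theta z \<le> t"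
  proof -
    have "theta z \<le> z * ln 4" by (rule theta_le)
    also have "\<dots> \<le> L / 16 * 1.3863" using z ln_4_le L(2) by (intro mult_mono) auto
    also have "\<dots> \<le> t" using L(2) by (simp add: t_def)
    finally show ?thesis .
  qed
  define w where "w = 0.598 / (l - 2.774)"
  have w: "mertens_prod z \<le> w"
  proof -
    have "mertens_prod z \<le> 0.598 / ln z" using z4000 by (intro mertens_prod_le_const) simp
    also have "\<dots> \<le> w" unfolding w_def using lnz l by (intro divide_left_mono) auto
    finally show ?thesis .
  qed
  define Y where "Y = (L - t - ln (101 * L) - ln X + (0::nat) * ln (X / z)) / ln X - 2"
  \<comment> \<open>The coefficient is \<open>1 - 0.08665\<close> less a margin for
    \<open>ln (101 * L) + 3 * ln X\<close>; the factor 3 combines the \<open>- ln X\<close> and the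
    \<open>- 2\<close> in \<open>Y\<close>.\<close>
  have Y_ge: "0.9128 * L / (l + 0.917) \<le> Y"
  proof -
    have "(0.9128 * L) / (l + 0.917) \<le> 0.9128 * L / ln X"
      using L(2) l lnX lnX_ge by (intro divide_left_mono) auto
    also have "\<dots> \<le> (L - t - ln (101 * L) - 3 * ln X) / ln X"
      using L(2) l lnX lnX_ge l101 l_le by (intro divide_right_mono) (auto simp: t_def)
    also have "\<dots> = Y" using l lnX_ge by (simp add: Y_def diff_divide_distrib)
    finally show ?thesis .
  qed
  have main1: "w * (L + ln (2 * L)) / 0.9212 \<le> Y"
  proof -
    have "w * (L + ln (2 * L)) / 0.9212 \<le> w * (1.0002 * L) / 0.9212"
      using l2 l_le l L(2) unfolding w_def by (intro divide_right_mono mult_left_mono) auto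
    also have "\<dots> \<le> 0.6494 * (L / (l - 2.774))"
    proof -
      define q where "q = L / (l - 2.774)"
      have "0 \<le> q" using l L(2) unfolding q_def by (intro divide_nonneg_nonneg) auto
      moreover have "w * (1.0002 * L) = 1.0002 * (0.598 * q)" by (simp add: w_def q_def)
      ultimately show ?thesis unfolding q_def[symmetric] by simp
    qed
    also have "\<dots> \<le> 0.9128 * L / (l + 0.917)"
    proof -
      \<comment> \<open>True from about \<open>l = 11.9\<close> on, which the assumption
        \<open>L >= 200000\<close> guarantees.\<close>
      have "0.6494 * (l + 0.917) \<le> 0.9128 * (l - 2.774)" using l by simp
      then have "(0.6494 * (l + 0.917)) * L \<le> (0.9128 * (l - 2.774)) * L"
        using L(2) by (intro mult_right_mono) auto
      then have "0.6494 * L * (l + 0.917) \<le> 0.9128 * L * (l - 2.774)"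
        by (simp only: mult_ac)
      then show ?thesis using l unfolding times_divide_eq_right
        by (intro frac_le_cross) auto
    qed
    finally show ?thesis using Y_ge by linarith
  qed
  have main2: "(z + (0::nat)) * (ln (X / z) / ln X) \<le> Y"
  proof -
    have "ln (real X / z) = ln X - ln z" using X L(2) z4000 by (simp add: ln_div)
    then have "ln (real X / z) \<le> 3.7" using lnX lnz by simp
    then have "(z + (0::nat)) * (ln (X / z) / ln X) \<le> L / 16 * (3.7 / ln X)"
      using z lnX_ge l L(2) z4000 zX by (intro mult_mono divide_right_mono) (auto intro!: divide_nonneg_nonneg)
    also have "\<dots> \<le> (L - t - ln (101 * L) - 3 * ln X) / ln X"
      using L(2) l lnX lnX_ge l101 l_le unfolding times_divide_eq_right
      by (intro divide_right_mono) (auto simp: t_def)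
    also have "\<dots> = Y" using l lnX_ge by (simp add: Y_def diff_divide_distrib)
    finally show ?thesis .
  qed
  have rec: "(\<Sum>p | prime p \<and> z < p \<and> p \<le> X. 1 / real p) \<le> 0.92"
  proof -
    have "real (2 * card (primes_le z)) \<le> real (z + 1)"
      using card_primes_le_le[of z] z4000 by (intro of_nat_mono) simp
    then have "3 * card (primes_le z) + 1 \<le> 0.04 * X - 2" using z X L(2) by simp
    then have "(3 * card (primes_le z) + 1) * ln X \<le> (0.04 * X - 2) * ln X"
      using lnX_ge l by (intro mult_right_mono) auto
    then have "(ln X + 1 + 3 * card (primes_le z) * ln X) \<le> 0.04 * ln X * X"
      using lnX_ge l by (simp add: algebra_simps)
    then have "(ln X + 1 + 3 * card (primes_le z) * ln X) / X \<le> 0.04 * ln X"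
      using X L(2) by (simp add: divide_le_eq)
    then have "ln X - ln z + ln 4 + (ln X + 1 + 3 * card (primes_le z) * ln X) / X \<le> 0.92 * ln z"
      using lnX lnz l ln_4_le by simp
    then have "(ln X - ln z + ln 4 + (ln X + 1 + 3 * card (primes_le z) * ln X) / X) / ln z \<le> 0.92"
      using lnz l by (simp add: divide_le_eq)
    with sum_recip_prime_between[of z X] z4000 zX show ?thesis by linarith
  qed
  show ?thesis
  proof (rule not_P_integer_if_bounds[OF L(1) _ _ order_refl zX X(1) w t _ rec _ Y_def main1 main2])
    show "4156 \<le> L" "500 \<le> z" using L(2) z4000 by auto
    show "theta z + ln (101 * L) \<le> L" using t l101 l_le L(2) by (simp add: t_def)
    have "{p. prime p \<and> z < p \<and> p \<le> z} = {}" by auto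
    then show "0 = card {p. prime p \<and> z < p \<and> p \<le> z}" by (simp only: card.empty)
  qed
qed

lemma card_primes_between:
  assumes "z \<le> V"
  shows "card {p. prime p \<and> z < p \<and> p \<le> V} + card (primes_le z) = card (primes_le V)"
proof -
  have "primes_le V = {p. prime p \<and> z < p \<and> p \<le> V} \<union> primes_le z" using assms by auto
  moreover have "finite {p. prime p \<and> z < p \<and> p \<le> V}"
    by (rule finite_subset[of _ "{..V}"]) auto
  ultimately show ?thesis by (simp only: card_Un_disjoint finite_primes_le) (subst card_Un_disjoint, auto)
qed

theorem corollary3:
  fixes k :: nat
  assumes "P_integer k"
  shows "k < 10 ^ 1805"
proof (rule ccontr)
  assume "\<not> k < 10 ^ 1805"
  then have "real (10 ^ 1805) \<le> real k" by (intro of_nat_mono) (simp only: not_less)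
  define L where "L = ln (real k)"
  note L = this
  have "ln (10::real) = 1 * ln 2 + 0 * ln 3 + 1 * ln 5" using ln_smooth[of 1 0 1] by simp
  then have "ln (10::real) \<ge> 2.30258" using ln_2_bounds ln_5_bounds by simp
  \<comment> \<open>The threshold 4156 is the integer part of \<open>ln (10 ^ 1805)\<close>.\<close>
  then have "1805 * ln (10::real) \<ge> 4156" by simp
  also have "1805 * ln (10::real) = ln (10 ^ 1805)" by (subst ln_realpow) simp_all
  also have "\<dots> = ln (real (10 ^ 1805))" by (simp only: of_nat_power of_nat_numeral)
  also have "\<dots> \<le> L"
    unfolding L
  proof (rule ln_mono)
    show "0 < real (10 ^ 1805)" by (simp only: of_nat_power of_nat_numeral zero_less_power zero_less_numeral)
  qed fact
  finally have L_ge: "4156 \<le> L" .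
  note lns = ln_2_bounds ln_3_bounds ln_5_bounds
  have ln_values: "6.2146 \<le> ln (500::real)" "6.9077 \<le> ln (1000::real)" "7.6008 \<le> ln (2000::real)"
    "ln (2000::real) \<le> 7.61" "8.294 \<le> ln (4000::real)" "ln (4000::real) \<le> 8.3"
    using ln_smooth[of 2 0 3] ln_smooth[of 3 0 3] ln_smooth[of 4 0 3] ln_smooth[of 5 0 3] lns by simp_all
  have theta: "theta 500 \<le> 478.37" "theta 1000 \<le> 963.14" "theta 2000 \<le> 1952.27" "theta 4000 \<le> 3935.18"
    using prime_bounds_500(2) prime_bounds_1000(2) prime_bounds_2000(2) prime_bounds_4000(2) lns by simp_all
  have mertens: "mertens_prod 500 \<le> 0.0896098" "mertens_prod 1000 \<le> 0.0809654"
    "mertens_prod 2000 \<le> 0.0736718" "mertens_prod 4000 \<le> 0.0675908"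
    using prime_bounds_500(1) prime_bounds_1000(1) prime_bounds_2000(1) prime_bounds_4000(1) by simp_all
  have card: "card {p::nat. prime p \<and> 500 < p \<and> p \<le> 2000} = 208"
    "card {p::nat. prime p \<and> 1000 < p \<and> p \<le> 2000} = 135"
    "card {p::nat. prime p \<and> 2000 < p \<and> p \<le> 2000} = 0"
    "card {p::nat. prime p \<and> 4000 < p \<and> p \<le> 4000} = 0"
    using card_primes_between[of 500 2000] card_primes_between[of 1000 2000]
      card_primes_between[of 2000 2000] card_primes_between[of 4000 4000]
      prime_bounds_500(3) prime_bounds_1000(3) prime_bounds_2000(3) prime_bounds_4000(3) by linarith+
  note facts_500 = ln_values(1,3,4) theta(1,3) mertens(1) card(1) prime_bounds_500(3)
  note facts_1000 = ln_values(2,3,4) theta(2,3) mertens(2) card(2) prime_bounds_1000(3)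
  note facts_2000 = ln_values(3,4) theta(3) mertens(3) card(3) prime_bounds_2000(3)
  note facts_4000 = ln_values(5,6) theta(4) mertens(4) card(4) prime_bounds_4000(3)
  \<comment> \<open>Eleven intervals, with \<open>z\<close> increasing along with \<open>L\<close>,
    and \<open>r = 0\<close> from 18000 on. Each right endpoint \<open>b\<close> is such that
    \<open>5 / 2 * b\<close> has only the prime factors 2, 3 and 5, so \<open>lX\<close> comes from
    a tangent at that number; \<open>ymin\<close> is the largest value, rounded down, allowed at
    \<open>L = a\<close>. In this first interval the condition
    \<open>(V + r) * (lX - lV) <= ymin * lX\<close> is tight, with about one percent to
    spare.\<close>
  have "\<not> P_integer k" if "4156 \<le> L" "L \<le> 4800"
  proof (rule not_P_integer_on_interval[where z = 500 and V = 2000 and r = 208 and a = 4156 and b = 4800 and lX = "9.393"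
        and lz = "6.2146" and lV = "7.6008" and w = "0.0896098" and t = "478.37" and c = 95 and ymin = "426.5", OF L that])
    show "ln (5 / 2 * 4800 + 1) \<le> (9.393 :: real)"
      using ln_le_tangent[of 12001 12000] ln_smooth[of 5 1 3] lns by simp
    fix L :: real assume "4156 \<le> L" "L \<le> 4800"
    then show "9.393 * (0.0896098 * (L + 9.393) + (3 - real 208) * 0.9212)
        \<le> (L - 478.37 - (9.393 + 3.71) - real 208 * (7.6008 + 0.01)) * 0.9212"
      by (simp add: field_simps)
  qed (use facts_500 in simp_all)
  moreover have "\<not> P_integer k" if "4800 \<le> L" "L \<le> 6000"
  proof (rule not_P_integer_on_interval[where z = 500 and V = 2000 and r = 208 and a = 4800 and b = 6000 and lX = "9.616"
        and lz = "6.2146" and lV = "7.6008" and w = "0.0896098" and t = "478.37" and c = 95 and ymin = "488.4", OF L that])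
    show "ln (5 / 2 * 6000 + 1) \<le> (9.616 :: real)"
      using ln_le_tangent[of 15001 15000] ln_smooth[of 3 1 4] lns by simp
    fix L :: real assume "4800 \<le> L" "L \<le> 6000"
    then show "9.616 * (0.0896098 * (L + 9.616) + (3 - real 208) * 0.9212)
        \<le> (L - 478.37 - (9.616 + 3.71) - real 208 * (7.6008 + 0.01)) * 0.9212"
      by (simp add: field_simps)
  qed (use facts_500 in simp_all)
  moreover have "\<not> P_integer k" if "6000 \<le> L" "L \<le> 8000"
  proof (rule not_P_integer_on_interval[where z = 500 and V = 2000 and r = 208 and a = 6000 and b = 8000 and lX = "9.904"
        and lz = "6.2146" and lV = "7.6008" and w = "0.0896098" and t = "478.37" and c = 95 and ymin = "601.3", OF L that])
    show "ln (5 / 2 * 8000 + 1) \<le> (9.904 :: real)"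
      using ln_le_tangent[of 20001 20000] ln_smooth[of 5 0 4] lns by simp
    fix L :: real assume "6000 \<le> L" "L \<le> 8000"
    then show "9.904 * (0.0896098 * (L + 9.904) + (3 - real 208) * 0.9212)
        \<le> (L - 478.37 - (9.904 + 3.71) - real 208 * (7.6008 + 0.01)) * 0.9212"
      by (simp add: field_simps)
  qed (use facts_500 in simp_all)
  moreover have "\<not> P_integer k" if "8000 \<le> L" "L \<le> 12000"
  proof (rule not_P_integer_on_interval[where z = 1000 and V = 2000 and r = 135 and a = 8000 and b = 12000 and lX = "10.309"
        and lz = "6.9077" and lV = "7.6008" and w = "0.0809654" and t = "963.14" and c = 168 and ymin = "713.5", OF L that])
    show "ln (5 / 2 * 12000 + 1) \<le> (10.309 :: real)"
      using ln_le_tangent[of 30001 30000] ln_smooth[of 4 1 4] lns by simp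
    fix L :: real assume "8000 \<le> L" "L \<le> 12000"
    then show "10.309 * (0.0809654 * (L + 10.309) + (3 - real 135) * 0.9212)
        \<le> (L - 963.14 - (10.309 + 3.71) - real 135 * (7.6008 + 0.01)) * 0.9212"
      by (simp add: field_simps)
  qed (use facts_1000 in simp_all)
  moreover have "\<not> P_integer k" if "12000 \<le> L" "L \<le> 18000"
  proof (rule not_P_integer_on_interval[where z = 1000 and V = 2000 and r = 135 and a = 12000 and b = 18000 and lX = "10.715"
        and lz = "6.9077" and lV = "7.6008" and w = "0.0809654" and t = "963.14" and c = 168 and ymin = "1064.8", OF L that])
    show "ln (5 / 2 * 18000 + 1) \<le> (10.715 :: real)"
      using ln_le_tangent[of 45001 45000] ln_smooth[of 3 2 4] lns by simp
    fix L :: real assume "12000 \<le> L" "L \<le> 18000"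
    then show "10.715 * (0.0809654 * (L + 10.715) + (3 - real 135) * 0.9212)
        \<le> (L - 963.14 - (10.715 + 3.71) - real 135 * (7.6008 + 0.01)) * 0.9212"
      by (simp add: field_simps)
  qed (use facts_1000 in simp_all)
  moreover have "\<not> P_integer k" if "18000 \<le> L" "L \<le> 24000"
  proof (rule not_P_integer_on_interval[where z = 2000 and V = 2000 and r = 0 and a = 18000 and b = 24000 and lX = "11.003"
        and lz = "7.6008" and lV = "7.6008" and w = "0.0736718" and t = "1952.27" and c = 303 and ymin = "1454.1", OF L that])
    show "ln (5 / 2 * 24000 + 1) \<le> (11.003 :: real)"
      using ln_le_tangent[of 60001 60000] ln_smooth[of 5 1 4] lns by simp
    fix L :: real assume "18000 \<le> L" "L \<le> 24000"
    then show "11.003 * (0.0736718 * (L + 11.003) + (3 - real 0) * 0.9212)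
        \<le> (L - 1952.27 - (11.003 + 3.71) - real 0 * (7.6008 + 0.01)) * 0.9212"
      by (simp add: field_simps)
  qed (use facts_2000 in simp_all)
  moreover have "\<not> P_integer k" if "24000 \<le> L" "L \<le> 36000"
  proof (rule not_P_integer_on_interval[where z = 2000 and V = 2000 and r = 0 and a = 24000 and b = 36000 and lX = "11.408"
        and lz = "7.6008" and lV = "7.6008" and w = "0.0736718" and t = "1952.27" and c = 303 and ymin = "1928.3", OF L that])
    show "ln (5 / 2 * 36000 + 1) \<le> (11.408 :: real)"
      using ln_le_tangent[of 90001 90000] ln_smooth[of 4 2 4] lns by simp
    fix L :: real assume "24000 \<le> L" "L \<le> 36000"
    then show "11.408 * (0.0736718 * (L + 11.408) + (3 - real 0) * 0.9212)
        \<le> (L - 1952.27 - (11.408 + 3.71) - real 0 * (7.6008 + 0.01)) * 0.9212"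
      by (simp add: field_simps)
  qed (use facts_2000 in simp_all)
  moreover have "\<not> P_integer k" if "36000 \<le> L" "L \<le> 50000"
  proof (rule not_P_integer_on_interval[where z = 2000 and V = 2000 and r = 0 and a = 36000 and b = 50000 and lX = "11.737"
        and lz = "7.6008" and lV = "7.6008" and w = "0.0736718" and t = "1952.27" and c = 303 and ymin = "2896.5", OF L that])
    show "ln (5 / 2 * 50000 + 1) \<le> (11.737 :: real)"
      using ln_le_tangent[of 125001 125000] ln_smooth[of 3 0 6] lns by simp
    fix L :: real assume "36000 \<le> L" "L \<le> 50000"
    then show "11.737 * (0.0736718 * (L + 11.737) + (3 - real 0) * 0.9212)
        \<le> (L - 1952.27 - (11.737 + 3.71) - real 0 * (7.6008 + 0.01)) * 0.9212"
      by (simp add: field_simps)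
  qed (use facts_2000 in simp_all)
  moreover have "\<not> P_integer k" if "50000 \<le> L" "L \<le> 80000"
  proof (rule not_P_integer_on_interval[where z = 4000 and V = 4000 and r = 0 and a = 50000 and b = 80000 and lX = "12.207"
        and lz = "8.2940" and lV = "8.2940" and w = "0.0675908" and t = "3935.18" and c = 550 and ymin = "3769.3", OF L that])
    show "ln (5 / 2 * 80000 + 1) \<le> (12.207 :: real)"
      using ln_le_tangent[of 200001 200000] ln_smooth[of 6 0 5] lns by simp
    fix L :: real assume "50000 \<le> L" "L \<le> 80000"
    then show "12.207 * (0.0675908 * (L + 12.207) + (3 - real 0) * 0.9212)
        \<le> (L - 3935.18 - (12.207 + 3.71) - real 0 * (8.2940 + 0.01)) * 0.9212"
      by (simp add: field_simps)
  qed (use facts_4000 in simp_all)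
  moreover have "\<not> P_integer k" if "80000 \<le> L" "L \<le> 129600"
  proof (rule not_P_integer_on_interval[where z = 4000 and V = 4000 and r = 0 and a = 80000 and b = 129600 and lX = "12.689"
        and lz = "8.2940" and lV = "8.2940" and w = "0.0675908" and t = "3935.18" and c = 550 and ymin = "5990.2", OF L that])
    show "ln (5 / 2 * 129600 + 1) \<le> (12.689 :: real)"
      using ln_le_tangent[of 324001 324000] ln_smooth[of 5 4 3] lns by simp
    fix L :: real assume "80000 \<le> L" "L \<le> 129600"
    then show "12.689 * (0.0675908 * (L + 12.689) + (3 - real 0) * 0.9212)
        \<le> (L - 3935.18 - (12.689 + 3.71) - real 0 * (8.2940 + 0.01)) * 0.9212"
      by (simp add: field_simps)
  qed (use facts_4000 in simp_all)
  moreover have "\<not> P_integer k" if "129600 \<le> L" "L \<le> 200000"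
  proof (rule not_P_integer_on_interval[where z = 4000 and V = 4000 and r = 0 and a = 129600 and b = 200000 and lX = "13.123"
        and lz = "8.2940" and lV = "8.2940" and w = "0.0675908" and t = "3935.18" and c = 550 and ymin = "9571.6", OF L that])
    show "ln (5 / 2 * 200000 + 1) \<le> (13.123 :: real)"
      using ln_le_tangent[of 500001 500000] ln_smooth[of 5 0 6] lns by simp
    fix L :: real assume "129600 \<le> L" "L \<le> 200000"
    then show "13.123 * (0.0675908 * (L + 13.123) + (3 - real 0) * 0.9212)
        \<le> (L - 3935.18 - (13.123 + 3.71) - real 0 * (8.2940 + 0.01)) * 0.9212"
      by (simp add: field_simps)
  qed (use facts_4000 in simp_all)
  moreover have "\<not> P_integer k" if "200000 \<le> L"
    using not_P_integer_large[OF L that] .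
  ultimately show False using L_ge assms by linarith
qed

end
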